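(* (Predicative cut elimination) Let $\alpha,\beta,\rho\prec\Omega$, $X\subseteq\vartheta(\varepsilon_{\Omega+1})$, and let $\eta$ be a term with $\Omega^2\preceq\eta$ and $\alpha\in\mathcal H_\eta(X)$. For every sequent $\Gamma$: if $\mathcal H_\eta[X]\vdash^\beta_{\rho+\omega(\alpha)}\Gamma$, then $\mathcal H_\eta[X]\vdash^{\overline\varphi(\alpha,\beta)}_\rho\Gamma$, where $\overline\varphi(\alpha,\beta):=\vartheta(\Omega\cdot\alpha+\beta)$.
   Context: Ordinal terms: The set $\vartheta(\varepsilon_{\Omega+1})$ of terms, a relation $\prec$ and finite sets $E(\alpha)$ are defined by simultaneous recursion on term length: Terms: $\Omega$; $\vartheta\alpha$ for each term $\alpha$; $\langle\alpha_0,\dots,\alpha_{n-1}\rangle$ ($n\ge0$) provided that if $n>1$ then $\alpha_{n-1}\preceq\dots\preceq\alpha_0$ ($\preceq$ is $\prec$ or syntactic equality), and if $n=1$ then $\alpha_0$ is not $\Omega$ or of the form $\vartheta\beta$. $E(\Omega)=\emptyset$, $E(\vartheta\alpha)=\{\vartheta\alpha\}$, $E(\langle\alpha_0,\dots\rangle)=\bigcup_iE(\alpha_i)$. $\alpha\prec\beta$ iff: (1) $\alpha=\Omega$, $\beta=\langle\beta_0,\dots,\beta_{n-1}\rangle$, $n>0$, $\Omega\preceq\beta_0$; or (2) $\alpha=\vartheta\alpha'$ and either $\beta=\Omega$, or $\beta=\langle\beta_0,\dots\rangle$ nonempty with $\alpha\preceq\beta_0$, or $\beta=\vartheta\beta'$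 with $\alpha'\prec\beta'$ and $\gamma\prec\beta$ for all $\gamma\in E(\alpha')$, or $\beta=\vartheta\beta'$ with $\alpha\preceq\gamma$ for some $\gamma\in E(\beta')$; or (3) $\alpha=\langle\alpha_0,\dots,\alpha_{m-1}\rangle$ and either $\beta\in\{\Omega\}\cup\{\vartheta\beta'\}$ with ($m=0$ or $\alpha_0\prec\beta$), or $\beta=\langle\beta_0,\dots,\beta_{n-1}\rangle$ is lexicographically larger ($\alpha$ a proper initial segment of $\beta$, or first difference $\alpha_j\prec\beta_j$). Numerals: $n:=\langle0,\dots,0\rangle$ ($n$ entries, $0=\langle\rangle$), $\omega:=\langle 1\rangle$. Arithmetic: identify $\Omega,\vartheta\alpha$ with $\langle\Omega\rangle,\langle\vartheta\alpha\rangle$; $\langle\alpha_0,\dots,\alpha_{m-1}\rangle+\langle\beta_0,\dots,\beta_{n-1}\rangle=\langle\alpha_0,\dots,\alpha_{k-1},\beta_0,\dots,\beta_{n-1}\rangle$ where $k$ is largest with $\beta_0\preceq\alpha_{k-1}$ (all of $\alpha$ if $n=0$; $k=0$ if no such); $\omega\cdot\Omega=\Omega$, $\omega\cdot\vartheta\alpha=\vartheta\alpha$, $\omega\cdot\langle\alpha_0,\dots\rangle=\langle1+\alpha_0,\dots\rangle$; $\Omega\cdot\langle\alpha_0,\dots,\alpha_{n-1}\rangle=\langle\Omega+\alpha_0,\dots,\Omega+\alpha_{n-1}\rangle$, $\Omega^2=\Omega\cdot\Omega$; $\omega(\alpha)=\alpha$ if $\alpha$ is $\Omega$ or of the form $\vartheta\alpha'$,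 and $\omega(\alpha)=\langle\alpha\rangle$ otherwise. Coefficient sets: $C_\alpha(\beta)$ is the least set containing $\Omega$ and all $\gamma\prec\beta$, containing $\vartheta\gamma$ whenever it contains $\gamma$ with $\gamma\prec\alpha$, and containing every term $\langle\gamma_0,\dots,\gamma_{n-1}\rangle$ whose entries it contains. $\mathcal H_\eta(Y)=\bigcap\{C_\gamma(\delta)\mid\eta\prec\gamma,\ Y\subseteq C_\gamma(\delta)\}$ (all terms if there are no such $\gamma,\delta$); $\mathcal H_\eta[X]$ is the operator $Y\mapsto\mathcal H_\eta(X\cup Y)$. Language: formulas are in negation normal form. An operator form is a formula $\varphi(x,X)$ of arithmetic with an extra unary predicate $X$, with one free number variable and no subformula $\neg Xt$. $\mathcal L^\Omega_{\mathsf{ID}}$ extends $\mathcal L_{\mathsf{PA}}$ by predicates $I^{\prec\alpha}_\varphi$ for each operator form $\varphi$ and term $\alpha\preceq\Omega$; $\varphi(t,I^{\prec\gamma}_\varphi)$ replaces $x$ by $t$ and $Xs$ by $I^{\prec\gamma}_\varphi s$. A sequent is a finite set of sentences. Each sentence is assigned a disjunction or conjunction: a false $\mathcal L_{\mathsf{PA}}$-literal $\simeq$ empty disjunction; $I^{\prec\alpha}_\varphi t\simeq\bigvee_{\gamma\prec\alpha}\varphi(t,I^{\prec\gamma}_\varphi)$; $\psi_0\lor\psi_1\simeq\bigvee_{i\prec2}\psi_i$; $\exists x\,\psi(x)\simeq\bigvee_{n\prec\omega}\psi(n)$; and $\neg\psi\simeq\bigwedge_{\gamma\prec\alpha}\neg\psi_\gamma$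 whenever $\psi\simeq\bigvee_{\gamma\prec\alpha}\psi_\gamma$. Ranks: $\operatorname{rk}=0$ for $\mathcal L_{\mathsf{PA}}$-literals, $\operatorname{rk}(\pm I^{\prec\alpha}_\varphi t)=\omega\cdot\alpha$, $\operatorname{rk}(\psi_0\lor\psi_1)=\operatorname{rk}(\psi_0\land\psi_1)=\max(\operatorname{rk}\psi_0,\operatorname{rk}\psi_1)+1$, $\operatorname{rk}(\exists x\psi)=\operatorname{rk}(\forall x\psi)=\operatorname{rk}(\psi)+1$. $k(\psi)$ is the set of $\alpha$ such that $\psi$ contains a literal $I^{\prec\alpha}_\varphi t$ or $\neg I^{\prec\alpha}_\varphi t$; $k(\Gamma)=\bigcup_{\psi\in\Gamma}k(\psi)$. Operators: a nice operator is $\mathcal H$ from subsets of terms to subsets of terms with $X\subseteq\mathcal H(X)$, ($X\subseteq\mathcal H(Y)\Rightarrow\mathcal H(X)\subseteq\mathcal H(Y)$), and ($\alpha\in\mathcal H(X)\Leftrightarrow E(\alpha)\subseteq\mathcal H(X)$); $\mathcal H[Z](X):=\mathcal H(Z\cup X)$. Derivations: $\mathcal H\vdash^\alpha_\rho\Gamma$ is defined by recursion on $\alpha$: it holds iff $\{\alpha\}\cup k(\Gamma)\subseteq\mathcal H(\emptyset)$ and one of: ($\bigwedge$) some $\psi\simeq\bigwedge_{\gamma\prec\delta}\psi_\gamma$ in $\Gamma$ such that for every $\gamma\prec\delta$ there is $\alpha(\gamma)\prec\alpha$ with $\mathcal H[\{\gamma\}]\vdash^{\alpha(\gamma)}_\rho\Gamma\cup\{\psi_\gamma\}$;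 ($\bigvee$) some $\psi\simeq\bigvee_{\gamma\prec\delta}\psi_\gamma$ in $\Gamma$, some $\gamma\prec\delta$ with $\gamma\prec\alpha$ and $\gamma\in\mathcal H(\emptyset)$, and $\alpha'\prec\alpha$ with $\mathcal H\vdash^{\alpha'}_\rho\Gamma\cup\{\psi_\gamma\}$; (Cut) some sentence $\psi$ with $\operatorname{rk}(\psi)\prec\rho$ and $\alpha'\prec\alpha$ with $\mathcal H\vdash^{\alpha'}_\rho\Gamma\cup\{\psi\}$ and $\mathcal H\vdash^{\alpha'}_\rho\Gamma\cup\{\neg\psi\}$; (Fix) $\Omega\preceq\alpha$, some $I^{\prec\Omega}_\varphi t\in\Gamma$ and $\alpha'\prec\alpha$ with $\mathcal H\vdash^{\alpha'}_\rho\Gamma\cup\{\varphi(t,I^{\prec\Omega}_\varphi)\}$. *)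

theory Defs
  imports Main
begin

section \<open>Ordinal terms\<close>

text \<open>
  The order is defined on all raw terms by recursion on their size; the set \<open>OT\<close> of genuine terms
  \<open>\<vartheta>(\<epsilon>\<^bsub>\<Omega>+1\<^esub>)\<close> is then carved out with its help. The term
  \<open>\<langle>\<alpha>\<^sub>0, \<dots>, \<alpha>\<^bsub>n-1\<^esub>\<rangle>\<close> is \<open>Sq [\<alpha>\<^sub>0, \<dots>, \<alpha>\<^bsub>n-1\<^esub>]\<close>.
\<close>

datatype oterm = Om | Th oterm | Sq "oterm list"

primrec Eset :: "oterm \<Rightarrow> oterm set" where
  "Eset Om = {}"
| "Eset (Th a) = {Th a}"
| "Eset (Sq as) = \<Union> (set (map Eset as))"

lemma size_Eset: "c \<in> Eset a \<Longrightarrow> size c \<le> size a"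
proof (induction a)
  case (Sq as)
  then obtain a where "a \<in> set as" "c \<in> Eset a" by auto
  moreover from this Sq.IH have "size c \<le> size a" by blast
  moreover from \<open>a \<in> set as\<close> have "size a \<le> size_list size as"
    by (simp add: size_list_estimation')
  ultimately show ?case by simp
qed auto

function (sequential) prec :: "oterm \<Rightarrow> oterm \<Rightarrow> bool"  (infix \<open>\<prec>\<close> 50) where
  "Om \<prec> Sq (b # bs) \<longleftrightarrow> Om \<prec> b \<or> Om = b"
| "Om \<prec> _ \<longleftrightarrow> False"
| "Th a \<prec> Om \<longleftrightarrow> True"
| "Th a \<prec> Sq [] \<longleftrightarrow> False"
| "Th a \<prec> Sq (b # bs) \<longleftrightarrow> Th a \<prec> b \<or> Th a = b"
| "Th a \<prec> Th b \<longleftrightarrow>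
     (a \<prec> b \<and> (\<forall>c\<in>Eset a. c \<prec> Th b)) \<or> (\<exists>c\<in>Eset b. Th a \<prec> c \<or> Th a = c)"
| "Sq as \<prec> Sq bs \<longleftrightarrow>
     (length as < length bs \<and> take (length as) bs = as) \<or>
     (\<exists>j\<in>{..<min (length as) (length bs)}. take j as = take j bs \<and> as ! j \<prec> bs ! j)"
| "Sq [] \<prec> b \<longleftrightarrow> True"
| "Sq (a # as) \<prec> b \<longleftrightarrow> a \<prec> b"
  by pat_completeness auto
termination
proof (relation "measure (\<lambda>(a, b). size a + size b)", goal_cases)
  case (7 as bs j)
  then have "size (as ! j) \<le> size_list size as" "size (bs ! j) \<le> size_list size bs"
    by (auto intro!: size_list_estimation'[OF nth_mem])
  then show ?case by simp
qed (auto dest: size_Eset)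

abbreviation preceq :: "oterm \<Rightarrow> oterm \<Rightarrow> bool"  (infix \<open>\<preceq>\<close> 50) where
  "a \<preceq> b \<equiv> a \<prec> b \<or> a = b"

primrec principal :: "oterm \<Rightarrow> bool" where
  "principal Om = True"
| "principal (Th a) = True"
| "principal (Sq as) = False"

inductive_set OT :: "oterm set" where
  "Om \<in> OT"
| "a \<in> OT \<Longrightarrow> Th a \<in> OT"
| "(\<And>a. a \<in> set as \<Longrightarrow> a \<in> OT) \<Longrightarrow>
     (length as > 1 \<Longrightarrow> successively (\<lambda>a b. b \<preceq> a) as) \<Longrightarrow>
     (length as = 1 \<Longrightarrow> \<not> principal (hd as)) \<Longrightarrow> Sq as \<in> OT"

definition seg :: "oterm \<Rightarrow> oterm set" where
  "seg a = {c \<in> OT. c \<prec> a}"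

section \<open>Ordinal arithmetic\<close>

definition onum :: "nat \<Rightarrow> oterm" where
  "onum n = Sq (replicate n (Sq []))"

definition oomega :: oterm where
  "oomega = Sq [onum 1]"

text \<open>\<open>entries\<close> and \<open>mk_seq\<close> implement the identification of \<open>\<Omega>\<close> and \<open>\<vartheta>\<alpha>\<close> with \<open>\<langle>\<Omega>\<rangle>\<close> and \<open>\<langle>\<vartheta>\<alpha>\<rangle>\<close>.\<close>

primrec entries :: "oterm \<Rightarrow> oterm list" where
  "entries Om = [Om]"
| "entries (Th a) = [Th a]"
| "entries (Sq as) = as"

definition mk_seq :: "oterm list \<Rightarrow> oterm" where
  "mk_seq as = (if length as = 1 \<and> principal (hd as) then hd as else Sq as)"

definition oadd :: "oterm \<Rightarrow> oterm \<Rightarrow> oterm"  (infixl \<open>\<oplus>\<close> 65) where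
  "a \<oplus> b =
    (let as = entries a; bs = entries b;
         k = (if bs = [] then length as
              else GREATEST k. k \<le> length as \<and> (k = 0 \<or> hd bs \<preceq> as ! (k - 1)))
     in mk_seq (take k as @ bs))"

primrec omega_times :: "oterm \<Rightarrow> oterm" where
  "omega_times Om = Om"
| "omega_times (Th a) = Th a"
| "omega_times (Sq as) = mk_seq (map (\<lambda>a. onum 1 \<oplus> a) as)"

definition Omega_times :: "oterm \<Rightarrow> oterm" where
  "Omega_times a = mk_seq (map (\<lambda>c. Om \<oplus> c) (entries a))"

definition omega_of :: "oterm \<Rightarrow> oterm" where
  "omega_of a = (if principal a then a else Sq [a])"

definition omax :: "oterm \<Rightarrow> oterm \<Rightarrow> oterm" where
  "omax a b = (if a \<preceq> b then b else a)"

definition phibar :: "oterm \<Rightarrow> oterm \<Rightarrow> oterm" where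
  "phibar a b = Th (Omega_times a \<oplus> b)"

section \<open>Operators\<close>

inductive_set Cset :: "oterm \<Rightarrow> oterm \<Rightarrow> oterm set" for a b :: oterm where
  "Om \<in> Cset a b"
| "c \<in> seg b \<Longrightarrow> c \<in> Cset a b"
| "c \<in> Cset a b \<Longrightarrow> c \<prec> a \<Longrightarrow> Th c \<in> Cset a b"
| "(\<And>c. c \<in> set cs \<Longrightarrow> c \<in> Cset a b) \<Longrightarrow> Sq cs \<in> OT \<Longrightarrow> Sq cs \<in> Cset a b"

definition Hop :: "oterm \<Rightarrow> oterm set \<Rightarrow> oterm set" where
  "Hop e Y = OT \<inter> \<Inter> {Cset c d | c d. c \<in> OT \<and> d \<in> OT \<and> e \<prec> c \<and> Y \<subseteq> Cset c d}"

definition adjoin :: "(oterm set \<Rightarrow> oterm set) \<Rightarrow> oterm set \<Rightarrow> oterm set \<Rightarrow> oterm set" where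
  "adjoin H Z = (\<lambda>X. H (Z \<union> X))"

section \<open>Formulas\<close>

datatype aterm = Var nat | Zero | Succ aterm | Plus aterm aterm | Times aterm aterm

primrec tfv :: "aterm \<Rightarrow> nat set" where
  "tfv (Var x) = {x}"
| "tfv Zero = {}"
| "tfv (Succ s) = tfv s"
| "tfv (Plus s t) = tfv s \<union> tfv t"
| "tfv (Times s t) = tfv s \<union> tfv t"

primrec tsubst :: "nat \<Rightarrow> aterm \<Rightarrow> aterm \<Rightarrow> aterm" where
  "tsubst x r (Var y) = (if y = x then r else Var y)"
| "tsubst x r Zero = Zero"
| "tsubst x r (Succ s) = Succ (tsubst x r s)"
| "tsubst x r (Plus s t) = Plus (tsubst x r s) (tsubst x r t)"
| "tsubst x r (Times s t) = Times (tsubst x r s) (tsubst x r t)"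

primrec tval :: "(nat \<Rightarrow> nat) \<Rightarrow> aterm \<Rightarrow> nat" where
  "tval e (Var x) = e x"
| "tval e Zero = 0"
| "tval e (Succ s) = Suc (tval e s)"
| "tval e (Plus s t) = tval e s + tval e t"
| "tval e (Times s t) = tval e s * tval e t"

definition anum :: "nat \<Rightarrow> aterm" where
  "anum n = (Succ ^^ n) Zero"

text \<open>Formulas of arithmetic in negation normal form with unary predicates drawn from \<open>'p\<close>.\<close>

datatype 'p fml =
    Eq aterm aterm | Neq aterm aterm
  | Pred 'p aterm | NPred 'p aterm
  | Or "'p fml" "'p fml" | And "'p fml" "'p fml"
  | Ex nat "'p fml" | All nat "'p fml"

primrec neg :: "'p fml \<Rightarrow> 'p fml" where
  "neg (Eq s t) = Neq s t"
| "neg (Neq s t) = Eq s t"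
| "neg (Pred p t) = NPred p t"
| "neg (NPred p t) = Pred p t"
| "neg (Or A B) = And (neg A) (neg B)"
| "neg (And A B) = Or (neg A) (neg B)"
| "neg (Ex x A) = All x (neg A)"
| "neg (All x A) = Ex x (neg A)"

primrec fv :: "'p fml \<Rightarrow> nat set" where
  "fv (Eq s t) = tfv s \<union> tfv t"
| "fv (Neq s t) = tfv s \<union> tfv t"
| "fv (Pred p t) = tfv t"
| "fv (NPred p t) = tfv t"
| "fv (Or A B) = fv A \<union> fv B"
| "fv (And A B) = fv A \<union> fv B"
| "fv (Ex x A) = fv A - {x}"
| "fv (All x A) = fv A - {x}"

text \<open>This substitution does not rename bound variables; it is only used with closed \<open>r\<close>.\<close>

primrec subst :: "nat \<Rightarrow> aterm \<Rightarrow> 'p fml \<Rightarrow> 'p fml" where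
  "subst x r (Eq s t) = Eq (tsubst x r s) (tsubst x r t)"
| "subst x r (Neq s t) = Neq (tsubst x r s) (tsubst x r t)"
| "subst x r (Pred p t) = Pred p (tsubst x r t)"
| "subst x r (NPred p t) = NPred p (tsubst x r t)"
| "subst x r (Or A B) = Or (subst x r A) (subst x r B)"
| "subst x r (And A B) = And (subst x r A) (subst x r B)"
| "subst x r (Ex y A) = Ex y (if y = x then A else subst x r A)"
| "subst x r (All y A) = All y (if y = x then A else subst x r A)"

primrec positive :: "'p fml \<Rightarrow> bool" where
  "positive (Eq s t) = True"
| "positive (Neq s t) = True"
| "positive (Pred p t) = True"
| "positive (NPred p t) = False"
| "positive (Or A B) = (positive A \<and> positive B)"
| "positive (And A B) = (positive A \<and> positive B)"
| "positive (Ex x A) = positive A"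
| "positive (All x A) = positive A"

text \<open>
  Formulas of arithmetic with the extra predicate \<open>X\<close> are elements of \<^typ>\<open>unit fml\<close>. The predicate
  \<open>I\<^sub>\<phi>\<^bsup>\<prec>\<alpha>\<^esup>\<close> is the pair \<open>(\<phi>, \<alpha>)\<close>.
\<close>

type_synonym idfml = "(unit fml \<times> oterm) fml"

definition operator_form :: "unit fml \<Rightarrow> bool" where
  "operator_form \<phi> \<longleftrightarrow> positive \<phi> \<and> (\<exists>x. fv \<phi> = {x})"

definition op_inst :: "unit fml \<Rightarrow> aterm \<Rightarrow> oterm \<Rightarrow> idfml" where
  "op_inst \<phi> t c = map_fml (\<lambda>_. (\<phi>, c)) (subst (THE x. fv \<phi> = {x}) t \<phi>)"

definition sentence :: "idfml \<Rightarrow> bool" where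
  "sentence A \<longleftrightarrow> fv A = {} \<and>
     (\<forall>(\<phi>, a) \<in> set_fml A. operator_form \<phi> \<and> a \<in> OT \<and> a \<preceq> Om)"

definition sequent :: "idfml set \<Rightarrow> bool" where
  "sequent \<Gamma> \<longleftrightarrow> finite \<Gamma> \<and> (\<forall>A\<in>\<Gamma>. sentence A)"

definition kset :: "idfml set \<Rightarrow> oterm set" where
  "kset \<Gamma> = (\<Union>A\<in>\<Gamma>. snd ` set_fml A)"

primrec rk :: "idfml \<Rightarrow> oterm" where
  "rk (Eq s t) = onum 0"
| "rk (Neq s t) = onum 0"
| "rk (Pred p t) = omega_times (snd p)"
| "rk (NPred p t) = omega_times (snd p)"
| "rk (Or A B) = omax (rk A) (rk B) \<oplus> onum 1"
| "rk (And A B) = omax (rk A) (rk B) \<oplus> onum 1"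
| "rk (Ex x A) = rk A \<oplus> onum 1"
| "rk (All x A) = rk A \<oplus> onum 1"

text \<open>
  \<open>disj_of A d f\<close> means \<open>A \<simeq> \<Or>\<^bsub>\<gamma>\<prec>d\<^esub> f \<gamma>\<close>, and \<open>conj_of A d f\<close> means \<open>A \<simeq> \<And>\<^bsub>\<gamma>\<prec>d\<^esub> f \<gamma>\<close>, for sentences \<open>A\<close>;
  values of \<open>f\<close> outside \<open>seg d\<close> are irrelevant. The elements of \<open>seg oomega\<close> are the numerals.
\<close>

inductive disj_of :: "idfml \<Rightarrow> oterm \<Rightarrow> (oterm \<Rightarrow> idfml) \<Rightarrow> bool" where
  "(\<And>e. tval e s \<noteq> tval e t) \<Longrightarrow> disj_of (Eq s t) (onum 0) f"
| "(\<And>e. tval e s = tval e t) \<Longrightarrow> disj_of (Neq s t) (onum 0) f"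
| "(\<And>c. c \<in> seg a \<Longrightarrow> f c = op_inst \<phi> t c) \<Longrightarrow> disj_of (Pred (\<phi>, a) t) a f"
| "f (onum 0) = A \<Longrightarrow> f (onum 1) = B \<Longrightarrow> disj_of (Or A B) (onum 2) f"
| "(\<And>n. f (onum n) = subst x (anum n) A) \<Longrightarrow> disj_of (Ex x A) oomega f"

inductive conj_of :: "idfml \<Rightarrow> oterm \<Rightarrow> (oterm \<Rightarrow> idfml) \<Rightarrow> bool" where
  "disj_of A d f \<Longrightarrow> conj_of (neg A) d (\<lambda>c. neg (f c))"

section \<open>Derivations\<close>

text \<open>
  \<open>deriv \<rho> H \<alpha> \<Gamma>\<close> is \<open>H \<turnstile>\<^sub>\<rho>\<^sup>\<alpha> \<Gamma>\<close>. As every premise of a rule carries a smaller ordinal term, the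
  inductive definition agrees with the recursion on \<open>\<alpha>\<close> along the well-founded order \<open>\<prec>\<close> on \<open>OT\<close>.
\<close>

inductive deriv :: "oterm \<Rightarrow> (oterm set \<Rightarrow> oterm set) \<Rightarrow> oterm \<Rightarrow> idfml set \<Rightarrow> bool"
  for \<rho> :: oterm where
  Conj: "{\<alpha>} \<union> kset \<Gamma> \<subseteq> H {} \<Longrightarrow> A \<in> \<Gamma> \<Longrightarrow> conj_of A d f \<Longrightarrow>
     (\<And>c. c \<in> seg d \<Longrightarrow> \<exists>\<alpha>'\<in>seg \<alpha>. deriv \<rho> (adjoin H {c}) \<alpha>' (\<Gamma> \<union> {f c})) \<Longrightarrow>
     deriv \<rho> H \<alpha> \<Gamma>"
| Disj: "{\<alpha>} \<union> kset \<Gamma> \<subseteq> H {} \<Longrightarrow> A \<in> \<Gamma> \<Longrightarrow> disj_of A d f \<Longrightarrow>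
     c \<in> seg d \<Longrightarrow> c \<prec> \<alpha> \<Longrightarrow> c \<in> H {} \<Longrightarrow>
     \<alpha>' \<in> seg \<alpha> \<Longrightarrow> deriv \<rho> H \<alpha>' (\<Gamma> \<union> {f c}) \<Longrightarrow>
     deriv \<rho> H \<alpha> \<Gamma>"
| Cut: "{\<alpha>} \<union> kset \<Gamma> \<subseteq> H {} \<Longrightarrow> sentence A \<Longrightarrow> rk A \<prec> \<rho> \<Longrightarrow>
     \<alpha>' \<in> seg \<alpha> \<Longrightarrow> deriv \<rho> H \<alpha>' (\<Gamma> \<union> {A}) \<Longrightarrow> deriv \<rho> H \<alpha>' (\<Gamma> \<union> {neg A}) \<Longrightarrow>
     deriv \<rho> H \<alpha> \<Gamma>"
| Fix: "{\<alpha>} \<union> kset \<Gamma> \<subseteq> H {} \<Longrightarrow> Om \<preceq> \<alpha> \<Longrightarrow> Pred (\<phi>, Om) t \<in> \<Gamma> \<Longrightarrow>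
     \<alpha>' \<in> seg \<alpha> \<Longrightarrow> deriv \<rho> H \<alpha>' (\<Gamma> \<union> {op_inst \<phi> t Om}) \<Longrightarrow>
     deriv \<rho> H \<alpha> \<Gamma>"

end

theory Submission
  imports Defs "HOL-Library.Multiset"
begin

text \<open>
  Main induction on \<open>\<alpha>\<close>, side induction on the derivation. A cut of rank \<open>\<sigma> \<succeq> \<rho>\<close> below \<open>\<rho> + \<omega>\<^bsup>\<alpha>\<^esup>\<close> either has
  \<open>\<sigma> = \<rho>\<close> and is removed by the usual reduction (inversion of the conjunctive side), or \<open>\<sigma>\<close> lies below
  \<open>\<rho> + \<omega>\<^bsup>\<alpha>'\<^esup> \<cdot> n\<close> for some \<open>\<alpha>' \<prec> \<alpha>\<close>, and the main induction hypothesis for \<open>\<alpha>'\<close> is applied \<open>n\<close> times. The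
  exponent \<open>\<alpha>'\<close> can be read off \<open>\<sigma>\<close>, hence it is controlled by the operator, and all heights stay below
  \<open>\<vartheta>(\<Omega>\<cdot>\<alpha> + \<beta>)\<close> because that term is closed under \<open>\<delta> \<mapsto> \<vartheta>(\<Omega>\<cdot>\<alpha>' + \<delta>)\<close>.

  The main induction needs the order to be well-founded below \<open>\<Omega>\<close>. Let \<open>W\<close> (\<open>acc_below_Om\<close>) be the
  accessible part of the terms below \<open>\<Omega>\<close>, and \<open>V\<close> the accessible part of the set \<open>acc_coeffs\<close> of terms \<open>a\<close> with
  \<open>E(a) \<subseteq> W\<close>. Both are closed under sequences, as lexicographic comparison of descending sequences is
  contained in the multiset order, and \<open>a \<in> V\<close> implies \<open>\<vartheta>a \<in> W\<close>. Thus every term lies in \<open>V\<close>.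
\<close>

subsection \<open>The linear order on terms\<close>

lemma Eset_is_Th: "e \<in> Eset a \<Longrightarrow> \<exists>x. e = Th x"
  by (induction a) auto

lemma size_Eset_less_Th: "e \<in> Eset a \<Longrightarrow> size e < size (Th a)"
  using size_Eset by fastforce

lemma entries_principal: "principal p \<Longrightarrow> entries p = [p]"
  by (cases p) auto

lemma Sq_entries: "\<not> principal a \<Longrightarrow> Sq (entries a) = a"
  by (cases a) auto

lemma entries_eq_Nil_iff [simp]: "entries a = [] \<longleftrightarrow> a = Sq []"
  by (cases a) auto

lemma not_prec_Sq_Nil [simp]: "\<not> a \<prec> Sq []"
  by (cases a) auto

lemma Sq_Nil_prec_iff [simp]: "Sq [] \<prec> a \<longleftrightarrow> a \<noteq> Sq []"
proof (cases a)
  case (Sq as)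
  then show ?thesis by (cases as) auto
qed auto

lemma Sq_Cons_prec_Sq_Cons [simp]:
  "Sq (a # as) \<prec> Sq (b # bs) \<longleftrightarrow> a \<prec> b \<or> a = b \<and> Sq as \<prec> Sq bs" (is "?l \<longleftrightarrow> ?r")
proof
  assume ?l
  then consider "length as < length bs" "b = a" "take (length as) bs = as"
    | j where "j < Suc (min (length as) (length bs))" "take j (a # as) = take j (b # bs)"
        "(a # as) ! j \<prec> (b # bs) ! j"
    by (auto simp del: take_Cons')
  then show ?r
  proof cases
    case (2 j)
    then show ?thesis by (cases j) auto
  qed auto
next
  assume ?r
  then consider "a \<prec> b" | "a = b" "length as < length bs" "take (length as) bs = as"
    | j where "a = b" "j < min (length as) (length bs)" "take j as = take j bs" "as ! j \<prec> bs ! j"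
    by auto
  then show ?l
  proof cases
    case 1
    then show ?thesis by (auto intro!: bexI[of _ 0])
  next
    case 3
    then show ?thesis by (auto intro!: bexI[of _ "Suc j"])
  qed auto
qed

declare prec.simps(9) [simp del]

lemma prec_Sq_Cons_principal: "principal p \<Longrightarrow> p \<prec> Sq (b # bs) \<longleftrightarrow> p \<preceq> b"
  by (cases p) auto

lemma Sq_Cons_prec_principal: "principal p \<Longrightarrow> Sq (a # as) \<prec> p \<longleftrightarrow> a \<prec> p"
  by (cases p) auto

text \<open>Reduces every comparison, except that of two principal terms, to smaller terms.\<close>

lemma prec_iff_hd_tl:
  assumes "a \<noteq> Sq []" "b \<noteq> Sq []"
  shows "a \<prec> b \<longleftrightarrow> hd (entries a) \<prec> hd (entries b) \<or> hd (entries a) = hd (entries b) \<and>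
    \<not> principal b \<and> (principal a \<or> Sq (tl (entries a)) \<prec> Sq (tl (entries b)))"
proof -
  consider "principal a" "principal b"
    | b0 bs where "principal a" "b = Sq (b0 # bs)"
    | a0 as where "a = Sq (a0 # as)" "principal b"
    | a0 as b0 bs where "a = Sq (a0 # as)" "b = Sq (b0 # bs)"
    using assms by (metis list.exhaust oterm.exhaust principal.simps(1,2))
  then show ?thesis
    by cases (auto simp: entries_principal prec_Sq_Cons_principal Sq_Cons_prec_principal)
qed

lemma size_hd_entries_less: "a \<noteq> Sq [] \<Longrightarrow> \<not> principal a \<Longrightarrow> size (hd (entries a)) < size a"
  by (cases a; cases "entries a") auto

lemma size_hd_entries_le: "a \<noteq> Sq [] \<Longrightarrow> size (hd (entries a)) \<le> size a"
  by (cases "principal a") (auto simp: entries_principal dest: size_hd_entries_less)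

lemma size_Sq_tl_entries_less: "a \<noteq> Sq [] \<Longrightarrow> \<not> principal a \<Longrightarrow> size (Sq (tl (entries a))) < size a"
  by (cases a; cases "entries a") auto

lemma Th_prec_Th_trans:
  assumes trans: "\<And>x y z. size x + size y + size z < size (Th a) + size (Th b) + size (Th c) \<Longrightarrow>
      x \<prec> y \<Longrightarrow> y \<prec> z \<Longrightarrow> x \<prec> z"
    and ab: "Th a \<prec> Th b" and bc: "Th b \<prec> Th c"
  shows "Th a \<prec> Th c"
proof -
  consider (coeff_c) e where "e \<in> Eset c" "Th b \<preceq> e"
    | (coeff_b) e where "e \<in> Eset b" "Th a \<preceq> e" "e \<prec> Th c"
    | (args) "a \<prec> b" "\<forall>e\<in>Eset a. e \<prec> Th b" "b \<prec> c"
    using ab bc by auto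
  then show ?thesis
  proof cases
    case coeff_c
    then have "Th a \<prec> e"
      using ab trans[of "Th a" "Th b" e] size_Eset[of e c] by auto
    then show ?thesis using coeff_c(1) by auto
  next
    case coeff_b
    then show ?thesis using trans[of "Th a" e "Th c"] size_Eset[of e b] by auto
  next
    case args
    have "a \<prec> c" using args trans[of a b c] by simp
    moreover have "e \<prec> Th c" if "e \<in> Eset a" for e
      using that args(2) bc trans[of e "Th b" "Th c"] size_Eset[of e a] by auto
    ultimately show ?thesis by simp
  qed
qed

lemma prec_trans_of_hd_tl:
  assumes "a \<noteq> Sq []" "a \<prec> b" "b \<prec> c"
    and hd_trans: "hd (entries a) \<prec> hd (entries b) \<Longrightarrow> hd (entries b) \<prec> hd (entries c) \<Longrightarrow>
      hd (entries a) \<prec> hd (entries c)"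
    and tl_trans: "\<not> principal a \<Longrightarrow> \<not> principal b \<Longrightarrow> \<not> principal c \<Longrightarrow>
      Sq (tl (entries a)) \<prec> Sq (tl (entries b)) \<Longrightarrow> Sq (tl (entries b)) \<prec> Sq (tl (entries c)) \<Longrightarrow>
      Sq (tl (entries a)) \<prec> Sq (tl (entries c))"
  shows "a \<prec> c"
proof -
  have nonzero: "b \<noteq> Sq []" "c \<noteq> Sq []" using assms(2,3) by auto
  show ?thesis
    using assms(2,3) hd_trans tl_trans
    unfolding prec_iff_hd_tl[OF assms(1) nonzero(1)] prec_iff_hd_tl[OF nonzero]
      prec_iff_hd_tl[OF assms(1) nonzero(2)]
    by metis
qed

lemma prec_trans: "a \<prec> b \<Longrightarrow> b \<prec> c \<Longrightarrow> a \<prec> c"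
proof (induction "size a + size b + size c" arbitrary: a b c rule: less_induct)
  case less
  have nonzero: "b \<noteq> Sq []" "c \<noteq> Sq []" using less.prems by auto
  consider (zero) "a = Sq []" | (principal) "principal a" "principal b" "principal c"
    | (sequence) "a \<noteq> Sq []" "\<not> (principal a \<and> principal b \<and> principal c)" by blast
  then show ?case
  proof cases
    case zero
    then show ?thesis using nonzero by simp
  next
    case principal
    show ?thesis
    proof (cases c)
      case Om
      then show ?thesis using principal less.prems by (cases a; cases b) auto
    next
      case (Th c')
      obtain a' b' where "a = Th a'" "b = Th b'"
        using principal less.prems Th by (cases a; cases b) auto
      then show ?thesis using Th_prec_Th_trans[of a' b' c'] less Th by blast
    qed (use principal in auto)
  next
    case sequence
    from sequence(1) less.prems show ?thesis
    proof (rule prec_trans_of_hd_tl)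
      have "size (hd (entries a)) + size (hd (entries b)) + size (hd (entries c)) <
        size a + size b + size c"
        using sequence nonzero
          size_hd_entries_le[of a] size_hd_entries_le[of b] size_hd_entries_le[of c]
          size_hd_entries_less[of a] size_hd_entries_less[of b] size_hd_entries_less[of c]
        by linarith
      then show "hd (entries a) \<prec> hd (entries b) \<Longrightarrow> hd (entries b) \<prec> hd (entries c) \<Longrightarrow>
        hd (entries a) \<prec> hd (entries c)" by (rule less.hyps)
      show "Sq (tl (entries a)) \<prec> Sq (tl (entries c))"
        if "\<not> principal a" "\<not> principal b" "\<not> principal c"
          "Sq (tl (entries a)) \<prec> Sq (tl (entries b))" "Sq (tl (entries b)) \<prec> Sq (tl (entries c))"
        by (rule less.hyps[OF _ that(4,5)])
          (use that sequence nonzero in \<open>intro add_strict_mono size_Sq_tl_entries_less\<close>)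
    qed
  qed
qed

lemma Th_Eset: "e \<in> Eset a \<Longrightarrow> e \<prec> Th a"
  using Eset_is_Th by fastforce

lemma prec_irrefl: "\<not> a \<prec> a"
proof (induction "size a" arbitrary: a rule: less_induct)
  case less
  consider (zero) "a = Sq []" | (Om) "a = Om" | (Th) b where "a = Th b"
    | (sequence) x xs where "a = Sq (x # xs)"
    by (metis oterm.exhaust list.exhaust)
  then show ?case
  proof cases
    case Th
    have "\<not> Th b \<preceq> e" if "e \<in> Eset b" for e
      using that less[of e] Th Th_Eset[of e b] prec_trans[of e "Th b" e] size_Eset_less_Th[of e b]
      by auto
    then show ?thesis using less[of b] Th by auto
  next
    case sequence
    then show ?thesis using less[of x] less[of "Sq xs"] by simp
  qed auto
qed

abbreviation comparable :: "oterm \<Rightarrow> oterm \<Rightarrow> bool" where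
  "comparable a b \<equiv> a \<prec> b \<or> a = b \<or> b \<prec> a"

lemma Th_prec_Th_or_prec_Th:
  assumes "a \<prec> b" "\<And>e. e \<in> Eset a \<Longrightarrow> comparable e (Th b)"
  shows "Th a \<prec> Th b \<or> Th b \<prec> Th a"
proof (cases "\<forall>e\<in>Eset a. e \<prec> Th b")
  case False
  then obtain e where "e \<in> Eset a" "Th b \<preceq> e" using assms(2) by metis
  then show ?thesis by auto
qed (use assms(1) in auto)

lemma comparable_of_hd_tl:
  assumes "a \<noteq> Sq []" "b \<noteq> Sq []" "\<not> (principal a \<and> principal b)"
    and hd: "comparable (hd (entries a)) (hd (entries b))"
    and tl: "\<not> principal a \<Longrightarrow> \<not> principal b \<Longrightarrow> comparable (Sq (tl (entries a))) (Sq (tl (entries b)))"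
  shows "comparable a b"
proof (cases "principal a \<or> principal b")
  case True
  then show ?thesis
    using hd assms(1-3) prec_iff_hd_tl[of a b] prec_iff_hd_tl[of b a] by metis
next
  case False
  then have "a = b" if "hd (entries a) = hd (entries b)" "tl (entries a) = tl (entries b)"
    using that assms(1,2) by (metis Sq_entries entries_eq_Nil_iff list.expand)
  then show ?thesis
    using hd tl False assms(1,2) prec_iff_hd_tl[of a b] prec_iff_hd_tl[of b a] by auto
qed

lemma prec_linear: "comparable a b"
proof (induction "size a + size b" arbitrary: a b rule: less_induct)
  case less
  consider (zero) "a = Sq [] \<or> b = Sq []" | (Om) "principal a" "principal b" "a = Om \<or> b = Om"
    | (Th) a' b' where "a = Th a'" "b = Th b'"
    | (sequence) "a \<noteq> Sq []" "b \<noteq> Sq []" "\<not> (principal a \<and> principal b)"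
    by (metis oterm.exhaust principal.simps(3))
  then show ?case
  proof cases
    case zero
    then show ?thesis by auto
  next
    case Om
    then show ?thesis by (cases a; cases b) auto
  next
    case Th
    have "comparable a' b'" using less[of a' b'] Th by simp
    moreover have "comparable e b" if "e \<in> Eset a'" for e
      using less[of e b] size_Eset_less_Th[OF that] Th by simp
    moreover have "comparable e a" if "e \<in> Eset b'" for e
      using less[of e a] size_Eset_less_Th[OF that] Th by simp
    ultimately show ?thesis
      using Th_prec_Th_or_prec_Th[of a' b'] Th_prec_Th_or_prec_Th[of b' a'] Th by blast
  next
    case sequence
    then show ?thesis
    proof (rule comparable_of_hd_tl)
      have "size (hd (entries a)) + size (hd (entries b)) < size a + size b"
        using sequence size_hd_entries_le[of a] size_hd_entries_le[of b]
          size_hd_entries_less[of a] size_hd_entries_less[of b] by linarith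
      then show "comparable (hd (entries a)) (hd (entries b))" by (rule less)
      show "comparable (Sq (tl (entries a))) (Sq (tl (entries b)))" if "\<not> principal a" "\<not> principal b"
        by (rule less) (use that sequence in \<open>intro add_strict_mono size_Sq_tl_entries_less\<close>)
    qed
  qed
qed

interpretation prec_order: linorder preceq prec
  by standard (use prec_trans prec_irrefl prec_linear in blast)+

lemma Sq_append_prec_Sq_append [simp]: "Sq (cs @ as) \<prec> Sq (cs @ bs) \<longleftrightarrow> Sq as \<prec> Sq bs"
  by (induction cs) auto

subsection \<open>Normal forms\<close>

abbreviation desc :: "oterm list \<Rightarrow> bool" where
  "desc \<equiv> sorted_wrt (\<lambda>a b. b \<preceq> a)"

lemma Sq_in_OT_iff:
  "Sq as \<in> OT \<longleftrightarrow> set as \<subseteq> OT \<and> desc as \<and> (length as = 1 \<longrightarrow> \<not> principal (hd as))" (is "?l \<longleftrightarrow> ?r")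
proof -
  have successively_iff: "successively (\<lambda>a b. b \<preceq> a) as \<longleftrightarrow> desc as"
    by (rule successively_iff_sorted_wrt_strong) (use prec_order.order_trans in blast)
  show ?thesis
  proof
    assume ?l
    then show ?r
    proof cases
      case 3
      then show ?thesis
        by (cases "length as > 1") (auto simp: successively_iff, cases as, auto)
    qed
  next
    assume ?r
    then show ?l by (auto intro!: OT.intros(3) simp: successively_iff)
  qed
qed

lemma Th_in_OT_iff [simp]: "Th a \<in> OT \<longleftrightarrow> a \<in> OT"
  using OT.cases[of "Th a"] OT.intros(2) by blast

lemma Om_in_OT [simp]: "Om \<in> OT"
  by (rule OT.intros)

lemma Sq_Nil_in_OT [simp]: "Sq [] \<in> OT"
  by (simp add: Sq_in_OT_iff)

lemma OT_induct [consumes 1, case_names Om Th Sq]: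
  assumes "a \<in> OT" "P Om" "\<And>a. a \<in> OT \<Longrightarrow> P a \<Longrightarrow> P (Th a)"
    "\<And>as. Sq as \<in> OT \<Longrightarrow> (\<And>a. a \<in> set as \<Longrightarrow> P a) \<Longrightarrow> P (Sq as)"
  shows "P a"
  using assms(1)
proof (induction rule: OT.induct)
  case (3 as)
  then show ?case using assms(4) OT.intros(3) by blast
qed (use assms in auto)

lemma entries_mk_seq [simp]: "entries (mk_seq as) = as"
  by (auto simp: mk_seq_def length_Suc_conv entries_principal)

lemma mk_seq_entries: "a \<in> OT \<Longrightarrow> mk_seq (entries a) = a"
  by (cases a) (auto simp: mk_seq_def Sq_in_OT_iff)

lemma entries_inj: "a \<in> OT \<Longrightarrow> b \<in> OT \<Longrightarrow> entries a = entries b \<Longrightarrow> a = b"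
  by (metis mk_seq_entries)

lemma entries_subset_OT: "a \<in> OT \<Longrightarrow> set (entries a) \<subseteq> OT"
  by (cases a) (auto simp: Sq_in_OT_iff)

lemma desc_entries: "a \<in> OT \<Longrightarrow> desc (entries a)"
  by (cases a) (auto simp: Sq_in_OT_iff)

lemma mk_seq_in_OT: "set as \<subseteq> OT \<Longrightarrow> desc as \<Longrightarrow> mk_seq as \<in> OT"
  by (cases "length as = 1 \<and> principal (hd as)")
    (auto simp: mk_seq_def Sq_in_OT_iff length_Suc_conv)

lemma desc_le_hd: "desc as \<Longrightarrow> x \<in> set as \<Longrightarrow> x \<preceq> hd as"
  by (cases as) auto

lemma mk_seq_prec_mk_seq [simp]: "mk_seq as \<prec> mk_seq bs \<longleftrightarrow> Sq as \<prec> Sq bs"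
  by (cases as; cases bs)
    (auto simp: mk_seq_def One_nat_def prec_Sq_Cons_principal Sq_Cons_prec_principal)

lemma prec_iff_entries:
  assumes "a \<in> OT" "b \<in> OT"
  shows "a \<prec> b \<longleftrightarrow> Sq (entries a) \<prec> Sq (entries b)"
  using mk_seq_prec_mk_seq[of "entries a" "entries b"] assms by (simp add: mk_seq_entries)

lemma Eset_mk_seq [simp]: "Eset (mk_seq as) = \<Union> (Eset ` set as)"
  by (auto simp: mk_seq_def length_Suc_conv)

lemma Union_Eset_entries [simp]: "\<Union> (Eset ` set (entries a)) = Eset a"
  by (cases a) auto

lemma omega_of_eq_mk_seq: "omega_of a = mk_seq [a]"
  by (simp add: omega_of_def mk_seq_def)

lemma omega_of_principal: "principal p \<Longrightarrow> omega_of p = p"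
  by (simp add: omega_of_def)

lemma entries_omega_of [simp]: "entries (omega_of a) = [a]"
  by (simp add: omega_of_eq_mk_seq)

lemma omega_of_in_OT: "a \<in> OT \<Longrightarrow> omega_of a \<in> OT"
  by (simp add: omega_of_eq_mk_seq mk_seq_in_OT)

lemma prec_omega_of_iff:
  assumes "a \<in> OT"
  shows "a \<prec> omega_of b \<longleftrightarrow> (\<forall>x\<in>set (entries a). x \<prec> b)"
proof -
  have "a \<prec> omega_of b \<longleftrightarrow> Sq (entries a) \<prec> Sq [b]"
    using mk_seq_prec_mk_seq[of "entries a" "[b]"] assms
    by (simp add: omega_of_eq_mk_seq mk_seq_entries)
  also have "\<dots> \<longleftrightarrow> (\<forall>x\<in>set (entries a). x \<prec> b)"
    using desc_le_hd[OF desc_entries[OF assms]]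
    by (cases "entries a") (auto intro: prec_order.le_less_trans)
  finally show ?thesis .
qed

lemma prec_principal_iff:
  "a \<in> OT \<Longrightarrow> principal p \<Longrightarrow> a \<prec> p \<longleftrightarrow> (\<forall>x\<in>set (entries a). x \<prec> p)"
  using prec_omega_of_iff[of a p] by (simp add: omega_of_principal)

lemma Eset_subset_OT: "a \<in> OT \<Longrightarrow> Eset a \<subseteq> OT"
  by (induction rule: OT_induct) auto

lemma Eset_le: "a \<in> OT \<Longrightarrow> e \<in> Eset a \<Longrightarrow> e \<preceq> a"
proof (induction rule: OT_induct)
  case (Sq as)
  then obtain x where x: "x \<in> set as" "e \<in> Eset x" by auto
  have "principal e" using Eset_is_Th[OF x(2)] by auto
  moreover have "\<not> x \<prec> e" using Sq.IH[OF x] prec_order.not_less by blast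
  ultimately have "\<not> Sq as \<prec> e" using prec_principal_iff[OF Sq.hyps(1)] x(1) by auto
  then show ?case using prec_order.not_less by blast
qed auto

lemma prec_Th_iff_Eset:
  assumes "a \<in> OT" "a \<prec> Om"
  shows "a \<prec> Th x \<longleftrightarrow> (\<forall>e\<in>Eset a. e \<prec> Th x)"
proof
  show "\<forall>e\<in>Eset a. e \<prec> Th x" if "a \<prec> Th x"
    using that Eset_le[OF assms(1)] prec_order.le_less_trans by blast
  show "a \<prec> Th x" if "\<forall>e\<in>Eset a. e \<prec> Th x"
    using assms that
  proof (induction rule: OT_induct)
    case (Th a)
    then show ?case by (metis Eset.simps(2) singletonI)
  next
    case (Sq as)
    then show ?case using prec_principal_iff[OF Sq.hyps] by auto
  qed simp
qed

subsection \<open>Well-foundedness below \<open>\<Omega>\<close>\<close>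

definition prec_on :: "oterm set \<Rightarrow> (oterm \<times> oterm) set" where
  "prec_on S = {(a, b). a \<in> S \<and> b \<in> S \<and> a \<prec> b}"

definition accpart :: "oterm set \<Rightarrow> oterm set" where
  "accpart S = S \<inter> Wellfounded.acc (prec_on S)"

lemma accpart_subset: "accpart S \<subseteq> S"
  by (simp add: accpart_def)

lemma accpartI: "a \<in> S \<Longrightarrow> (\<And>b. b \<in> S \<Longrightarrow> b \<prec> a \<Longrightarrow> b \<in> accpart S) \<Longrightarrow> a \<in> accpart S"
  by (auto simp: accpart_def prec_on_def intro: acc.intros)

lemma accpart_downward: "a \<in> accpart S \<Longrightarrow> b \<in> S \<Longrightarrow> b \<preceq> a \<Longrightarrow> b \<in> accpart S"
  by (auto simp: accpart_def prec_on_def intro: acc_downward)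

lemma accpart_induct [consumes 1, case_names less]:
  assumes "a \<in> accpart S"
    and less: "\<And>a. a \<in> accpart S \<Longrightarrow> (\<And>b. b \<in> S \<Longrightarrow> b \<prec> a \<Longrightarrow> P b) \<Longrightarrow> P a"
  shows "P a"
proof -
  have "a \<in> S" "a \<in> Wellfounded.acc (prec_on S)" using assms(1) by (auto simp: accpart_def)
  from this(2,1) show ?thesis
  proof (induction rule: acc.induct)
    case (accI a)
    then have "a \<in> accpart S" by (auto simp: accpart_def intro: acc.intros)
    then show ?case using accI less by (auto simp: prec_on_def)
  qed
qed

lemma wf_prec_on_accpart: "wf (prec_on (accpart S))"
proof (rule acc_wfI, rule allI)
  fix a
  show "a \<in> Wellfounded.acc (prec_on (accpart S))"
  proof (cases "a \<in> accpart S")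
    case True
    have "prec_on (accpart S) \<subseteq> prec_on S" using accpart_subset by (auto simp: prec_on_def)
    from acc_subset[OF this] True show ?thesis by (auto simp: accpart_def)
  qed (auto simp: prec_on_def intro: acc.intros)
qed

lemma Sq_prec_imp_mult:
  assumes "Sq bs \<prec> Sq as" "desc bs" "set as \<subseteq> W" "set bs \<subseteq> W"
  shows "(mset bs, mset as) \<in> mult (prec_on W)"
  using assms
proof (induction bs arbitrary: as)
  case Nil
  then have "as \<noteq> []" by auto
  then show ?case using one_step_implies_mult[of "mset as" "{#}" "prec_on W" "{#}"] by simp
next
  case (Cons b bs)
  then obtain a as' where as: "as = a # as'" by (cases as) auto
  show ?case
  proof (cases "b \<prec> a")
    case True
    have "x \<prec> a" if "x \<in> set (b # bs)" for x
      using desc_le_hd[OF Cons.prems(2) that] True prec_order.le_less_trans by auto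
    then have "({#} + mset (b # bs), {#} + mset as) \<in> mult (prec_on W)"
      by (intro one_step_implies_mult)
        (use Cons.prems as in \<open>auto simp: prec_on_def intro!: bexI[of _ a]\<close>)
    then show ?thesis by simp
  next
    case False
    then have "b = a" "(mset bs, mset as') \<in> mult (prec_on W)"
      using Cons.prems Cons.IH[of as'] as by auto
    moreover have "trans (prec_on W)"
      by (rule transI) (auto simp: prec_on_def intro: prec_order.less_trans)
    moreover have "irrefl_on {a} (prec_on W)" by (simp add: irrefl_on_def prec_on_def)
    ultimately show ?thesis
      using mult_cancel_add_mset[of "prec_on W" a "mset bs" "mset as'"] as by simp
  qed
qed

definition hereditary :: "oterm set \<Rightarrow> bool" where
  "hereditary S \<longleftrightarrow> S \<subseteq> OT \<and> (\<forall>a\<in>OT. a \<in> S \<longleftrightarrow> set (entries a) \<subseteq> S)"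

lemma hereditary_accpart:
  assumes S: "hereditary S" and a: "a \<in> OT" "set (entries a) \<subseteq> accpart S"
  shows "a \<in> accpart S"
  using wf_mult[OF wf_prec_on_accpart[of S]] a
proof (induction "mset (entries a)" arbitrary: a rule: wf_induct_rule)
  case less
  show ?case
  proof (rule accpartI)
    show "a \<in> S" using less.prems S accpart_subset by (auto simp: hereditary_def)
    fix b assume b: "b \<in> S" "b \<prec> a"
    then have b_OT: "b \<in> OT" and b_entries: "set (entries b) \<subseteq> S"
      using S by (auto simp: hereditary_def)
    have lex: "Sq (entries b) \<prec> Sq (entries a)"
      using b(2) prec_iff_entries[OF b_OT less.prems(1)] by simp
    have "x \<in> accpart S" if "x \<in> set (entries b)" for x
    proof -
      have "x \<preceq> hd (entries b)" using desc_le_hd[OF desc_entries[OF b_OT] that] .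
      moreover have "hd (entries b) \<preceq> hd (entries a)"
        using lex that by (cases "entries a"; cases "entries b") auto
      ultimately have "x \<preceq> hd (entries a)" by (rule prec_order.order_trans)
      moreover have "hd (entries a) \<in> accpart S"
        using lex less.prems(2) by (cases "entries a") auto
      ultimately show ?thesis using accpart_downward b_entries that by blast
    qed
    then have sub: "set (entries b) \<subseteq> accpart S" by blast
    show "b \<in> accpart S"
      using less.hyps[OF Sq_prec_imp_mult[OF lex desc_entries[OF b_OT] less.prems(2) sub] b_OT sub] .
  qed
qed

abbreviation acc_below_Om :: "oterm set" where
  "acc_below_Om \<equiv> accpart (seg Om)"

definition acc_coeffs :: "oterm set" where
  "acc_coeffs = {a \<in> OT. Eset a \<subseteq> acc_below_Om}"

lemma hereditary_seg_Om: "hereditary (seg Om)"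
  using entries_subset_OT prec_principal_iff[of _ Om] by (auto simp: hereditary_def seg_def)

lemma hereditary_acc_coeffs: "hereditary acc_coeffs"
  using entries_subset_OT Union_Eset_entries unfolding hereditary_def acc_coeffs_def by blast

lemma in_acc_below_Om_iff:
  assumes "a \<in> OT" "a \<prec> Om"
  shows "a \<in> acc_below_Om \<longleftrightarrow> Eset a \<subseteq> acc_below_Om"
proof
  show "Eset a \<subseteq> acc_below_Om" if "a \<in> acc_below_Om"
    using that accpart_downward[OF that] Eset_le[OF assms(1)] Eset_subset_OT[OF assms(1)]
      prec_order.le_less_trans[OF _ assms(2)] by (auto simp: seg_def)
  show "a \<in> acc_below_Om" if "Eset a \<subseteq> acc_below_Om"
    using assms that
  proof (induction rule: OT_induct)
    case (Sq as)
    then show ?case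
      using hereditary_accpart[OF hereditary_seg_Om Sq.hyps] prec_principal_iff[OF Sq.hyps, of Om]
      by auto
  qed auto
qed

lemma acc_below_Om_subset_accpart: "acc_below_Om \<subseteq> accpart acc_coeffs"
proof
  fix a assume "a \<in> acc_below_Om"
  then show "a \<in> accpart acc_coeffs"
  proof (induction rule: accpart_induct)
    case (less a)
    then have a: "a \<in> OT" "a \<prec> Om" using accpart_subset by (auto simp: seg_def)
    show ?case
    proof (rule accpartI)
      show "a \<in> acc_coeffs" using less(1) a in_acc_below_Om_iff[OF a] by (simp add: acc_coeffs_def)
      show "b \<in> accpart acc_coeffs" if "b \<in> acc_coeffs" "b \<prec> a" for b
        using less(2)[of b] that prec_order.less_trans[of b a Om] a
        by (simp add: acc_coeffs_def seg_def)
    qed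
  qed
qed

lemma Om_in_accpart_acc_coeffs: "Om \<in> accpart acc_coeffs"
proof (rule accpartI)
  fix b assume "b \<in> acc_coeffs" "b \<prec> Om"
  then have "b \<in> acc_below_Om" using in_acc_below_Om_iff[of b] by (simp add: acc_coeffs_def)
  then show "b \<in> accpart acc_coeffs" using acc_below_Om_subset_accpart by blast
qed (simp add: acc_coeffs_def)

lemma Th_prec_Th_in_acc_below_Om:
  assumes a: "a \<in> acc_coeffs"
    and Th_smaller: "\<And>b. b \<in> acc_coeffs \<Longrightarrow> b \<prec> a \<Longrightarrow> Th b \<in> acc_below_Om"
    and "b \<in> OT" "Th b \<prec> Th a"
  shows "Th b \<in> acc_below_Om"
  using assms(3,4)
proof (induction "size b" arbitrary: b rule: less_induct)
  case less
  show ?case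
  proof (cases "\<exists>e\<in>Eset a. Th b \<preceq> e")
    case True
    then show ?thesis
      using a less.prems(1) by (auto simp: acc_coeffs_def seg_def intro: accpart_downward)
  next
    case False
    then have b: "b \<prec> a" "\<And>e. e \<in> Eset b \<Longrightarrow> e \<prec> Th a" using less.prems by auto
    have "e \<in> acc_below_Om" if e: "e \<in> Eset b" for e
    proof -
      obtain c where "e = Th c" using Eset_is_Th[OF e] by blast
      then show ?thesis
        using less.hyps[of c] size_Eset[OF e] Eset_subset_OT[OF less.prems(1)] e b(2)[OF e] by auto
    qed
    then show ?thesis using Th_smaller b(1) less.prems(1) by (auto simp: acc_coeffs_def)
  qed
qed

lemma Th_in_acc_below_Om: "a \<in> accpart acc_coeffs \<Longrightarrow> Th a \<in> acc_below_Om"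
proof (induction rule: accpart_induct)
  case (less a)
  then have a: "a \<in> acc_coeffs" using accpart_subset by blast
  show ?case
  proof (rule accpartI)
    show "Th a \<in> seg Om" using a by (simp add: acc_coeffs_def seg_def)
    fix c assume "c \<in> seg Om" "c \<prec> Th a"
    then have c: "c \<in> OT" "c \<prec> Om" by (auto simp: seg_def)
    have "e \<in> acc_below_Om" if e: "e \<in> Eset c" for e
    proof -
      obtain b where "e = Th b" using Eset_is_Th[OF e] by blast
      moreover have "e \<prec> Th a" using e \<open>c \<prec> Th a\<close> prec_Th_iff_Eset[OF c] by blast
      ultimately show ?thesis
        using Th_prec_Th_in_acc_below_Om[OF a less(2)] Eset_subset_OT[OF c(1)] e
        by (auto simp del: prec.simps)
    qed
    then show "c \<in> acc_below_Om" using in_acc_below_Om_iff[OF c] by blast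
  qed
qed

lemma OT_subset_accpart_acc_coeffs: "OT \<subseteq> accpart acc_coeffs"
proof
  fix a assume "a \<in> OT"
  then show "a \<in> accpart acc_coeffs"
  proof (induction rule: OT_induct)
    case (Th a)
    then show ?case using Th_in_acc_below_Om acc_below_Om_subset_accpart by blast
  next
    case (Sq as)
    then show ?case by (intro hereditary_accpart[OF hereditary_acc_coeffs]) auto
  qed (rule Om_in_accpart_acc_coeffs)
qed

lemma seg_Om_induct [consumes 2, case_names less]:
  assumes "a \<in> OT" "a \<prec> Om"
    and less: "\<And>a. a \<in> OT \<Longrightarrow> a \<prec> Om \<Longrightarrow> (\<And>b. b \<in> OT \<Longrightarrow> b \<prec> a \<Longrightarrow> P b) \<Longrightarrow> P a"
  shows "P a"
proof -
  have "a \<in> acc_coeffs" using assms(1) OT_subset_accpart_acc_coeffs accpart_subset by blast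
  then have "a \<in> acc_below_Om" using in_acc_below_Om_iff[OF assms(1,2)] by (simp add: acc_coeffs_def)
  then show ?thesis
  proof (induction rule: accpart_induct)
    case (less a)
    then have "a \<in> OT" "a \<prec> Om" using accpart_subset by (auto simp: seg_def)
    then show ?case using assms(3)[of a] less(2) prec_order.less_trans[of _ a Om] by (simp add: seg_def)
  qed
qed

subsection \<open>Arithmetic\<close>

text \<open>Otherwise the simplifier rewrites \<^term>\<open>onum 1\<close> to \<^term>\<open>onum (Suc 0)\<close>.\<close>

declare One_nat_def [simp del]

lemma Greatest_eq_length_takeWhile:
  assumes "sorted_wrt (\<lambda>x y. P y \<longrightarrow> P x) as"
  shows "(GREATEST k. k \<le> length as \<and> (k = 0 \<or> P (as ! (k - 1)))) = length (takeWhile P as)"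
proof (rule Greatest_equality)
  let ?n = "length (takeWhile P as)"
  have "P (as ! (?n - 1))" if "?n \<noteq> 0"
    using that takeWhile_nth[of "?n - 1" P as] nth_mem[of "?n - 1" "takeWhile P as"]
    by (auto dest: set_takeWhileD)
  then show "?n \<le> length as \<and> (?n = 0 \<or> P (as ! (?n - 1)))" by (auto simp: length_takeWhile_le)
  fix k assume k: "k \<le> length as \<and> (k = 0 \<or> P (as ! (k - 1)))"
  show "k \<le> ?n"
  proof (rule ccontr)
    assume less: "\<not> k \<le> ?n"
    then have "P (as ! ?n)"
      using k sorted_wrt_nth_less[OF assms, of ?n "k - 1"] by (cases "?n = k - 1") auto
    then show False using nth_length_takeWhile[of P as] k less by auto
  qed
qed

lemma oadd_eq:
  assumes "desc (entries a)"
  shows "a \<oplus> b = mk_seq (takeWhile (\<lambda>x. b = Sq [] \<or> hd (entries b) \<preceq> x) (entries a) @ entries b)"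
proof (cases "b = Sq []")
  case True
  then show ?thesis by (simp add: oadd_def takeWhile_eq_all_conv[THEN iffD2])
next
  case False
  define P where "P = (\<lambda>x. hd (entries b) \<preceq> x)"
  have "sorted_wrt (\<lambda>x y. P y \<longrightarrow> P x) (entries a)"
    by (rule sorted_wrt_mono_rel[OF _ assms]) (use prec_order.order_trans in \<open>auto simp: P_def\<close>)
  from Greatest_eq_length_takeWhile[OF this] show ?thesis
    using False by (simp add: oadd_def Let_def P_def takeWhile_eq_take[symmetric])
qed

lemma entries_oadd:
  assumes "a \<in> OT"
  shows "entries (a \<oplus> b) = takeWhile (\<lambda>x. b = Sq [] \<or> hd (entries b) \<preceq> x) (entries a) @ entries b"
  by (simp add: oadd_eq[OF desc_entries[OF assms]])

lemma oadd_append: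
  assumes "a \<in> OT" "\<And>x. x \<in> set (entries a) \<Longrightarrow> b \<noteq> Sq [] \<Longrightarrow> hd (entries b) \<preceq> x"
  shows "a \<oplus> b = mk_seq (entries a @ entries b)"
proof -
  have "takeWhile (\<lambda>x. b = Sq [] \<or> hd (entries b) \<preceq> x) (entries a) = entries a"
    unfolding takeWhile_eq_all_conv using assms(2) by blast
  then show ?thesis unfolding oadd_eq[OF desc_entries[OF assms(1)]] by (rule arg_cong)
qed

lemma oadd_zero [simp]: "a \<in> OT \<Longrightarrow> a \<oplus> Sq [] = a"
  by (simp add: oadd_append mk_seq_entries)

lemma oadd_in_OT:
  assumes "a \<in> OT" "b \<in> OT"
  shows "a \<oplus> b \<in> OT"
proof -
  let ?as = "takeWhile (\<lambda>x. b = Sq [] \<or> hd (entries b) \<preceq> x) (entries a)"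
  have "desc ?as" by (rule sorted_wrt_takeWhile[OF desc_entries[OF assms(1)]])
  moreover have "y \<preceq> x" if "x \<in> set ?as" "y \<in> set (entries b)" for x y
    using set_takeWhileD[OF that(1)] desc_le_hd[OF desc_entries[OF assms(2)] that(2)] that(2)
      prec_order.order_trans[of y "hd (entries b)" x] by auto
  ultimately have "desc (?as @ entries b)"
    using desc_entries[OF assms(2)] by (simp add: sorted_wrt_append)
  moreover have "set (?as @ entries b) \<subseteq> OT"
    using entries_subset_OT[OF assms(1)] entries_subset_OT[OF assms(2)] by (auto dest: set_takeWhileD)
  ultimately show ?thesis by (simp add: oadd_eq[OF desc_entries[OF assms(1)]] mk_seq_in_OT)
qed

lemma set_entries_oadd: "a \<in> OT \<Longrightarrow> set (entries (a \<oplus> b)) \<subseteq> set (entries a) \<union> set (entries b)"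
  by (auto simp: entries_oadd dest: set_takeWhileD)

lemma Eset_oadd_subset: "a \<in> OT \<Longrightarrow> Eset (a \<oplus> b) \<subseteq> Eset a \<union> Eset b"
  using set_entries_oadd[of a b] by (subst (1 2 3) Union_Eset_entries[symmetric]) blast

lemma Eset_subset_Eset_oadd: "a \<in> OT \<Longrightarrow> Eset b \<subseteq> Eset (a \<oplus> b)"
  by (subst (1 2) Union_Eset_entries[symmetric]) (auto simp: entries_oadd)

lemma oadd_prec_omega_of:
  "a \<in> OT \<Longrightarrow> b \<in> OT \<Longrightarrow> a \<prec> omega_of c \<Longrightarrow> b \<prec> omega_of c \<Longrightarrow> a \<oplus> b \<prec> omega_of c"
  using set_entries_oadd[of a b] by (auto simp: prec_omega_of_iff oadd_in_OT)

lemma oadd_prec_principal: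
  "a \<in> OT \<Longrightarrow> b \<in> OT \<Longrightarrow> principal p \<Longrightarrow> a \<prec> p \<Longrightarrow> b \<prec> p \<Longrightarrow> a \<oplus> b \<prec> p"
  using oadd_prec_omega_of[of a b p] by (simp add: omega_of_principal)

lemma oadd_strict_mono_right:
  assumes "a \<in> OT" "b \<in> OT" "c \<in> OT" "b \<prec> c"
  shows "a \<oplus> b \<prec> a \<oplus> c"
proof -
  define P where "P = (\<lambda>b x. b = Sq [] \<or> hd (entries b) \<preceq> x)"
  define w where "w = dropWhile (P c) (entries a)"
  have lex: "Sq (entries b) \<prec> Sq (entries c)" using assms prec_iff_entries by blast
  then have "c \<noteq> Sq []" by auto
  have "hd (entries b) \<preceq> hd (entries c)" if "b \<noteq> Sq []"
    using lex that by (cases "entries b"; cases "entries c") auto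
  then have "P b x" if "P c x" for x
    using that \<open>c \<noteq> Sq []\<close> prec_order.order_trans[of _ "hd (entries c)" x] by (auto simp: P_def)
  then have "takeWhile (P b) (takeWhile (P c) (entries a) @ w) =
    takeWhile (P c) (entries a) @ takeWhile (P b) w"
    by (intro takeWhile_append2) (blast dest: set_takeWhileD)
  then have split: "takeWhile (P b) (entries a) = takeWhile (P c) (entries a) @ takeWhile (P b) w"
    by (simp add: w_def)
  have "Sq (takeWhile (P b) w @ entries b) \<prec> Sq (entries c)"
  proof (cases "takeWhile (P b) w")
    case (Cons x xs)
    then obtain ys where "w = x # ys" by (cases w) (auto split: if_splits)
    then have "\<not> P c x" using hd_dropWhile[of "P c" "entries a"] by (simp add: w_def)
    then have "x \<prec> hd (entries c)" using \<open>c \<noteq> Sq []\<close> prec_order.not_less by (auto simp: P_def)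
    then show ?thesis using Cons \<open>c \<noteq> Sq []\<close> by (cases "entries c") auto
  qed (use lex in simp)
  then show ?thesis
    using split by (simp add: oadd_eq[OF desc_entries[OF assms(1)]] P_def)
qed

lemma oadd_in_seg: "a \<in> OT \<Longrightarrow> b \<in> OT \<Longrightarrow> c \<in> seg b \<Longrightarrow> a \<oplus> c \<in> seg (a \<oplus> b)"
  by (simp add: seg_def oadd_in_OT oadd_strict_mono_right)

lemma oadd_ge_left: "a \<in> OT \<Longrightarrow> b \<in> OT \<Longrightarrow> a \<preceq> a \<oplus> b"
  using oadd_strict_mono_right[of a "Sq []" b] by (cases "b = Sq []") auto

lemma Sq_le_Sq_append:
  assumes "desc bs" "\<And>x. x \<in> set as \<Longrightarrow> bs \<noteq> [] \<Longrightarrow> hd bs \<preceq> x"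
  shows "Sq bs \<preceq> Sq (as @ bs)"
  using assms
proof (induction bs arbitrary: as)
  case (Cons b bs)
  show ?case
  proof (cases as)
    case as: (Cons a as')
    have "Sq bs \<preceq> Sq ((as' @ [b]) @ bs)"
    proof (rule Cons.IH)
      fix x assume x: "x \<in> set (as' @ [b])" "bs \<noteq> []"
      then have "hd bs \<preceq> b" "b \<preceq> x" using Cons.prems as by auto
      then show "hd bs \<preceq> x" by (rule prec_order.order_trans)
    qed (use Cons.prems in simp)
    then show ?thesis using Cons.prems(2)[of a] as by auto
  qed simp
qed auto

lemma oadd_ge_right:
  assumes "a \<in> OT" "b \<in> OT"
  shows "b \<preceq> a \<oplus> b"
proof -
  have "Sq (entries b) \<preceq> Sq (entries (a \<oplus> b))"
    unfolding entries_oadd[OF assms(1)]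
    by (rule Sq_le_Sq_append) (auto simp: desc_entries[OF assms(2)] dest: set_takeWhileD)
  then show ?thesis
    using prec_iff_entries[of b "a \<oplus> b"] entries_inj[of b "a \<oplus> b"] assms oadd_in_OT by auto
qed

text \<open>Both multiplications are of the form \<open>\<omega>\<^sup>d \<cdot> a\<close>, since \<open>\<Omega> = \<omega>\<^sup>\<Omega>\<close>.\<close>

definition omega_pow_times :: "oterm \<Rightarrow> oterm \<Rightarrow> oterm" where
  "omega_pow_times d a = mk_seq (map (\<lambda>c. d \<oplus> c) (entries a))"

lemma Omega_times_eq: "Omega_times a = omega_pow_times Om a"
  by (simp add: Omega_times_def omega_pow_times_def)

lemma onum_0: "onum 0 = Sq []"
  by (simp add: onum_def)

lemma onum_1: "onum 1 = Sq [Sq []]"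
  by (simp add: onum_def One_nat_def)

lemma entries_onum [simp]: "entries (onum n) = replicate n (Sq [])"
  by (simp add: onum_def)

lemma onum_eq_Sq_Nil_iff [simp]: "onum n = Sq [] \<longleftrightarrow> n = 0"
  by (simp add: onum_def)

lemma onum_in_OT [simp]: "onum n \<in> OT"
  unfolding onum_def Sq_in_OT_iff by (induction n) auto

lemma omega_times_eq: "omega_times a = omega_pow_times (onum 1) a"
proof -
  have "onum 1 \<oplus> p = p" if "principal p" for p
    using that by (subst oadd_eq) (auto simp: onum_1 entries_principal mk_seq_def)
  then show ?thesis by (cases a) (auto simp: omega_pow_times_def mk_seq_def)
qed

lemma Sq_map_prec_Sq_map:
  assumes "\<And>x y. x \<in> set as \<Longrightarrow> y \<in> set bs \<Longrightarrow> x \<prec> y \<Longrightarrow> g x \<prec> g y" "Sq as \<prec> Sq bs"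
  shows "Sq (map g as) \<prec> Sq (map g bs)"
  using assms
proof (induction as arbitrary: bs)
  case Nil
  then show ?case by (cases bs) auto
next
  case (Cons a as)
  then show ?case by (cases bs) auto
qed

context
  fixes d :: oterm
  assumes d: "d \<in> OT"
begin

lemma omega_pow_times_in_OT:
  assumes "a \<in> OT"
  shows "omega_pow_times d a \<in> OT"
  unfolding omega_pow_times_def
proof (rule mk_seq_in_OT)
  show "desc (map (\<lambda>c. d \<oplus> c) (entries a))"
    unfolding sorted_wrt_map
    by (rule sorted_wrt_mono_rel[OF _ desc_entries[OF assms]])
      (use oadd_strict_mono_right[OF d] entries_subset_OT[OF assms] in blast)
qed (use oadd_in_OT[OF d] entries_subset_OT[OF assms] in auto)

lemma omega_pow_times_strict_mono:
  assumes "a \<in> OT" "b \<in> OT" "a \<prec> b"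
  shows "omega_pow_times d a \<prec> omega_pow_times d b"
  unfolding omega_pow_times_def mk_seq_prec_mk_seq
  by (rule Sq_map_prec_Sq_map)
    (use assms prec_iff_entries oadd_strict_mono_right[OF d] entries_subset_OT in blast)+

lemma entries_omega_pow_times_ge: "a \<in> OT \<Longrightarrow> x \<in> set (entries (omega_pow_times d a)) \<Longrightarrow> d \<preceq> x"
  using oadd_ge_left[OF d] entries_subset_OT by (auto simp: omega_pow_times_def)

lemma Eset_omega_pow_times:
  assumes "Eset d = {}"
  shows "Eset (omega_pow_times d a) = Eset a"
proof -
  have "Eset (d \<oplus> c) = Eset c" for c
    using Eset_oadd_subset[OF d, of c] Eset_subset_Eset_oadd[OF d, of c] assms by auto
  then show ?thesis by (simp add: omega_pow_times_def)
qed

lemma oadd_prec_omega_pow_times: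
  assumes a: "a \<in> OT" and b: "b \<in> OT" "b \<prec> omega_pow_times d a" and c: "c \<in> OT" "c \<prec> omega_of d"
  shows "b \<oplus> c \<prec> omega_pow_times d a"
proof -
  have "Sq (takeWhile P xs @ zs) \<prec> Sq ys"
    if "Sq xs \<prec> Sq ys" "\<And>y z. y \<in> set ys \<Longrightarrow> z \<in> set zs \<Longrightarrow> z \<prec> y" for P xs ys zs
    using that
  proof (induction xs arbitrary: ys)
    case Nil
    then show ?case by (cases ys; cases zs) auto
  next
    case (Cons x xs)
    then show ?case by (cases ys; cases zs) auto
  qed
  moreover have "Sq (entries b) \<prec> Sq (entries (omega_pow_times d a))"
    using prec_iff_entries[OF b(1) omega_pow_times_in_OT[OF a]] b(2) by blast
  moreover have "z \<prec> y" if "y \<in> set (entries (omega_pow_times d a))" "z \<in> set (entries c)" for y z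
    using entries_omega_pow_times_ge[OF a that(1)] prec_omega_of_iff[OF c(1)] c(2) that(2)
      prec_order.less_le_trans[of z d y] by blast
  ultimately have "Sq (entries (b \<oplus> c)) \<prec> Sq (entries (omega_pow_times d a))"
    unfolding entries_oadd[OF b(1)] by blast
  then show ?thesis
    using prec_iff_entries[OF oadd_in_OT[OF b(1) c(1)] omega_pow_times_in_OT[OF a]] by blast
qed

end

lemma prec_oadd_one: "a \<in> OT \<Longrightarrow> a \<prec> a \<oplus> onum 1"
  using oadd_strict_mono_right[of a "Sq []" "onum 1"] by simp

lemma Eset_onum [simp]: "Eset (onum n) = {}"
  by (simp add: onum_def)

lemma omega_times_in_OT: "a \<in> OT \<Longrightarrow> omega_times a \<in> OT"
  by (simp add: omega_times_eq omega_pow_times_in_OT)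

lemma oadd_one_prec_omega_times:
  "a \<in> OT \<Longrightarrow> b \<in> OT \<Longrightarrow> b \<prec> omega_times a \<Longrightarrow> b \<oplus> onum 1 \<prec> omega_times a"
  unfolding omega_times_eq by (rule oadd_prec_omega_pow_times) (auto simp: prec_omega_of_iff)

lemma onum_prec_iff [simp]: "onum m \<prec> onum n \<longleftrightarrow> m < n"
proof (induction m arbitrary: n)
  case 0
  then show ?case by (cases n) (auto simp: onum_def)
next
  case (Suc m)
  then show ?case by (cases n) (auto simp: onum_def)
qed

lemma onum_eq_iff [simp]: "onum m = onum n \<longleftrightarrow> m = n"
  by (metis onum_prec_iff linorder_cases less_irrefl)

lemma onum_prec_principal: "principal p \<Longrightarrow> onum n \<prec> p"
  by (cases p) (auto simp: prec_principal_iff)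

lemma seg_oomegaE:
  assumes "c \<in> seg oomega"
  obtains n where "c = onum n"
proof -
  have c: "c \<in> OT" "c \<prec> omega_of (onum 1)"
    using assms by (auto simp: seg_def oomega_def omega_of_def onum_1)
  have "x = Sq []" if "x \<in> set (entries c)" for x
  proof -
    have "x \<prec> Sq [Sq []]" using that c prec_omega_of_iff by (auto simp: onum_1)
    then show ?thesis using prec_iff_hd_tl[of x "Sq [Sq []]"] by (cases x) auto
  qed
  then have "entries c = replicate (length (entries c)) (Sq [])" by (simp add: replicate_length_same)
  then have "c = onum (length (entries c))"
    using entries_inj[OF c(1) onum_in_OT[of "length (entries c)"]] by (simp add: onum_def)
  then show ?thesis using that by blast
qed

lemma seg_onum_0 [simp]: "seg (onum 0) = {}"
  by (simp add: seg_def onum_0)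

lemma seg_onum_2: "seg (onum 2) = {onum 0, onum 1}"
proof -
  have "onum 2 \<prec> oomega" by (simp add: onum_def oomega_def numeral_2_eq_2)
  then have "seg (onum 2) \<subseteq> seg oomega"
    using prec_order.less_trans[of _ "onum 2" oomega] by (auto simp: seg_def)
  then have "seg (onum 2) \<subseteq> range onum" using seg_oomegaE by blast
  then have "seg (onum 2) = onum ` {..<2}" by (auto simp: seg_def)
  also have "{..<2} = {0, 1 :: nat}" by auto
  finally show ?thesis by simp
qed

subsection \<open>The function \<open>phibar\<close>\<close>

lemma Eset_Omega_times_oadd:
  assumes "a \<in> OT" "b \<in> OT" "b \<prec> Om"
  shows "Eset (Omega_times a \<oplus> b) = Eset a \<union> Eset b"
proof -
  have a: "Omega_times a \<in> OT" "Eset (Omega_times a) = Eset a"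
    using assms(1) omega_pow_times_in_OT Eset_omega_pow_times by (auto simp: Omega_times_eq)
  have "Omega_times a \<oplus> b = mk_seq (entries (Omega_times a) @ entries b)"
  proof (rule oadd_append[OF a(1)])
    fix x assume "x \<in> set (entries (Omega_times a))" "b \<noteq> Sq []"
    then have "Om \<preceq> x" "hd (entries b) \<prec> Om"
      using entries_omega_pow_times_ge[OF _ assms(1), of Om x] assms(3)
        prec_principal_iff[OF assms(2), of Om]
      by (auto simp: Omega_times_eq)
    then show "hd (entries b) \<preceq> x" using prec_order.less_le_trans by blast
  qed
  then show ?thesis using a(2) by (simp add: image_Un)
qed

lemma Omega_times_oadd_in_OT: "a \<in> OT \<Longrightarrow> b \<in> OT \<Longrightarrow> Omega_times a \<oplus> b \<in> OT"
  by (simp add: Omega_times_eq oadd_in_OT omega_pow_times_in_OT)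

lemma Omega_times_oadd_prec:
  assumes "a \<in> OT" "b \<in> OT" "a \<prec> b" "c \<in> OT" "c \<prec> Om"
  shows "Omega_times a \<oplus> c \<prec> Omega_times b"
  unfolding Omega_times_eq
  by (rule oadd_prec_omega_pow_times)
    (use assms omega_pow_times_in_OT omega_pow_times_strict_mono in \<open>auto simp: omega_of_def\<close>)

lemma phibar_in_OT: "a \<in> OT \<Longrightarrow> b \<in> OT \<Longrightarrow> phibar a b \<in> OT"
  by (simp add: phibar_def Omega_times_oadd_in_OT)

lemma principal_phibar [simp]: "principal (phibar a b)"
  by (simp add: phibar_def)

lemma phibar_prec_Om [simp]: "phibar a b \<prec> Om"
  by (simp add: phibar_def)

context
  fixes a b :: oterm
  assumes a: "a \<in> OT" "a \<prec> Om" and b: "b \<in> OT" "b \<prec> Om"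
begin

lemma Eset_prec_phibar: "e \<in> Eset a \<union> Eset b \<Longrightarrow> e \<prec> phibar a b"
  unfolding phibar_def by (rule Th_Eset) (use Eset_Omega_times_oadd[OF a(1) b] in simp)

lemma prec_phibar: "a \<prec> phibar a b" "b \<prec> phibar a b"
  using a b Eset_prec_phibar unfolding phibar_def by (auto simp: prec_Th_iff_Eset)

lemma phibar_prec_phibar:
  assumes "a' \<in> OT" "a' \<prec> phibar a b" "b' \<in> OT" "b' \<prec> phibar a b"
    and "Omega_times a' \<oplus> b' \<prec> Omega_times a \<oplus> b"
  shows "phibar a' b' \<prec> phibar a b"
proof -
  have "b' \<prec> Om" using assms(4) phibar_prec_Om by (rule prec_order.less_trans)
  then have "e \<prec> phibar a b" if "e \<in> Eset (Omega_times a' \<oplus> b')" for e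
    using that Eset_Omega_times_oadd[OF assms(1,3)] Eset_le[OF assms(1)] Eset_le[OF assms(3)]
      assms(2,4) prec_order.le_less_trans[of e] by blast
  then show ?thesis using assms(5) by (simp add: phibar_def)
qed

lemma phibar_strict_mono_right:
  assumes "b' \<in> OT" "b' \<prec> b"
  shows "phibar a b' \<prec> phibar a b"
  using assms a(1) b(1) prec_phibar prec_order.less_trans[OF assms(2)] omega_pow_times_in_OT
  by (intro phibar_prec_phibar oadd_strict_mono_right) (auto simp: Omega_times_eq)

lemma phibar_closed:
  assumes "a' \<in> OT" "a' \<prec> a" "c \<in> OT" "c \<prec> phibar a b"
  shows "phibar a' c \<prec> phibar a b"
proof (rule phibar_prec_phibar[OF assms(1) _ assms(3,4)])
  show "a' \<prec> phibar a b" using assms(2) prec_phibar(1) by (rule prec_order.less_trans)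
  have "Omega_times a' \<oplus> c \<prec> Omega_times a"
    using assms a(1) prec_order.less_trans[OF assms(4) phibar_prec_Om] by (intro Omega_times_oadd_prec)
  also have "Omega_times a \<preceq> Omega_times a \<oplus> b"
    using a(1) b(1) omega_pow_times_in_OT by (intro oadd_ge_left) (auto simp: Omega_times_eq)
  finally (prec_order.less_le_trans) show "Omega_times a' \<oplus> c \<prec> Omega_times a \<oplus> b" .
qed

end

subsection \<open>Splitting cut ranks\<close>

definition oadd_copies :: "oterm \<Rightarrow> oterm \<Rightarrow> nat \<Rightarrow> oterm" where
  "oadd_copies r a n = ((\<lambda>x. x \<oplus> omega_of a) ^^ n) r"

lemma oadd_copies_simps [simp]:
  "oadd_copies r a 0 = r" "oadd_copies r a (Suc n) = oadd_copies r a n \<oplus> omega_of a"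
  by (simp_all add: oadd_copies_def)

lemma oadd_copies_in_OT: "r \<in> OT \<Longrightarrow> a \<in> OT \<Longrightarrow> oadd_copies r a n \<in> OT"
  by (induction n) (auto simp: oadd_in_OT omega_of_in_OT)

lemma oadd_copies_prec_Om:
  assumes "r \<in> OT" "r \<prec> Om" "a \<in> OT" "a \<prec> Om"
  shows "oadd_copies r a n \<prec> Om"
proof (induction n)
  case (Suc n)
  then show ?case
    using assms by (auto intro!: oadd_prec_principal
        simp: oadd_copies_in_OT omega_of_in_OT prec_principal_iff[of "omega_of a" Om])
qed (use assms in simp)

lemma entries_oadd_omega_of:
  assumes "r \<in> OT"
  shows "entries (r \<oplus> omega_of a) = takeWhile (\<lambda>x. a \<preceq> x) (entries r) @ [a]"
proof -
  have "omega_of a \<noteq> Sq []" by (metis entries_omega_of entries_eq_Nil_iff list.distinct(1))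
  then show ?thesis by (simp add: entries_oadd[OF assms])
qed

lemma entries_oadd_copies:
  assumes "r \<in> OT" "a \<in> OT"
  shows "entries (oadd_copies r a (Suc n)) = takeWhile (\<lambda>x. a \<preceq> x) (entries r) @ replicate (Suc n) a"
proof (induction n)
  case 0
  then show ?case using entries_oadd_omega_of[OF assms(1)] by simp
next
  case (Suc n)
  let ?l = "takeWhile (\<lambda>x. a \<preceq> x) (entries r) @ replicate (Suc n) a"
  have "entries (oadd_copies r a (Suc (Suc n))) = takeWhile (\<lambda>x. a \<preceq> x) ?l @ [a]"
    using entries_oadd_omega_of[OF oadd_copies_in_OT[OF assms, of "Suc n"]] Suc
    by (simp only: oadd_copies_simps)
  also have "takeWhile (\<lambda>x. a \<preceq> x) ?l = ?l"
    unfolding takeWhile_eq_all_conv by (auto dest: set_takeWhileD)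
  finally show ?case by (simp add: replicate_append_same)
qed

lemma Sq_prec_appendE:
  assumes "Sq s \<prec> Sq (r @ v)" "\<not> Sq s \<prec> Sq (r @ u)"
  obtains t where "s = r @ t" "Sq t \<prec> Sq v" "\<not> Sq t \<prec> Sq u"
proof -
  have "\<exists>t. s = r @ t \<and> Sq t \<prec> Sq v \<and> \<not> Sq t \<prec> Sq u"
    using assms
  proof (induction r arbitrary: s)
    case (Cons x r)
    then obtain y s' where s: "s = y # s'" by (cases s) auto
    then have "y = x" "Sq s' \<prec> Sq (r @ v)" "\<not> Sq s' \<prec> Sq (r @ u)" using Cons.prems by auto
    then show ?case using Cons.IH s by auto
  qed simp
  then show ?thesis using that by blast
qed

lemma Sq_prec_of_length_less:
  assumes "\<And>x y. x \<in> set t \<Longrightarrow> y \<in> set v \<Longrightarrow> x \<preceq> y" "length t < length v"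
  shows "Sq t \<prec> Sq v"
  using assms
proof (induction t arbitrary: v)
  case (Cons x t)
  then obtain y v' where v: "v = y # v'" by (cases v) auto
  then have "x \<preceq> y" using Cons.prems(1)[of x y] by simp
  then show ?case using Cons.IH[of v'] Cons.prems v by auto
qed auto

lemma entries_between_oadd_omega_of:
  assumes r: "r \<in> OT" and s: "s \<in> OT" and a: "a \<in> OT"
    and s_less: "s \<prec> r \<oplus> omega_of a" and r_le: "r \<preceq> s" and "s \<noteq> r"
  obtains a' t where "a' \<prec> a" "entries s = takeWhile (\<lambda>x. a \<preceq> x) (entries r) @ a' # t"
proof -
  define r' where "r' = takeWhile (\<lambda>x. a \<preceq> x) (entries r)"
  define u where "u = dropWhile (\<lambda>x. a \<preceq> x) (entries r)"
  have entries_r: "entries r = r' @ u" by (simp add: r'_def u_def)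
  have "Sq (entries s) \<prec> Sq (r' @ [a])"
    using s_less prec_iff_entries[OF s oadd_in_OT[OF r omega_of_in_OT[OF a]]]
    by (simp add: entries_oadd_omega_of r r'_def)
  moreover have "\<not> Sq (entries s) \<prec> Sq (r' @ u)"
    using r_le prec_iff_entries[OF s r] entries_r prec_order.not_less by metis
  ultimately obtain t where t: "entries s = r' @ t" "Sq t \<prec> Sq [a]" "\<not> Sq t \<prec> Sq u"
    by (rule Sq_prec_appendE)
  have "t \<noteq> []"
    using t(1,3) entries_r entries_inj[OF s r] \<open>s \<noteq> r\<close> by auto
  then obtain a' t' where "t = a' # t'" by (cases t) auto
  then show ?thesis using that t r'_def by auto
qed

lemma prec_oadd_copies:
  assumes r: "r \<in> OT" and s: "s \<in> OT" and "a' \<prec> a"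
    and entries_s: "entries s = takeWhile (\<lambda>x. a \<preceq> x) (entries r) @ a' # t"
  shows "s \<prec> oadd_copies r a' (Suc (length (a' # t)))"
proof -
  define r' where "r' = takeWhile (\<lambda>x. a \<preceq> x) (entries r)"
  define w where "w = takeWhile (\<lambda>x. a' \<preceq> x) (dropWhile (\<lambda>x. a \<preceq> x) (entries r))"
  let ?copies = "replicate (Suc (length (a' # t))) a'"
  have a': "a' \<in> OT" using entries_subset_OT[OF s] entries_s by simp
  have "a' \<preceq> x" if "x \<in> set r'" for x
    using that \<open>a' \<prec> a\<close> prec_order.less_le_trans unfolding r'_def by (blast dest: set_takeWhileD)
  then have "takeWhile (\<lambda>x. a' \<preceq> x) (r' @ dropWhile (\<lambda>x. a \<preceq> x) (entries r)) = r' @ w"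
    unfolding w_def by (intro takeWhile_append2)
  then have "takeWhile (\<lambda>x. a' \<preceq> x) (entries r) = r' @ w" by (simp add: r'_def)
  then have "entries (oadd_copies r a' (Suc (length (a' # t)))) = r' @ w @ ?copies"
    using entries_oadd_copies[OF r a', of "length (a' # t)"] by simp
  moreover have "Sq (a' # t) \<prec> Sq (w @ ?copies)"
  proof (rule Sq_prec_of_length_less)
    fix x y assume x: "x \<in> set (a' # t)" and y: "y \<in> set (w @ ?copies)"
    have "desc (a' # t)" using desc_entries[OF s] entries_s by (simp add: sorted_wrt_append)
    then have "x \<preceq> a'" using desc_le_hd[OF _ x] by simp
    moreover have "a' \<preceq> y" using y by (auto simp: w_def dest: set_takeWhileD)
    ultimately show "x \<preceq> y" by (rule prec_order.order_trans)
  qed simp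
  ultimately show ?thesis
    using prec_iff_entries[OF s oadd_copies_in_OT[OF r a', of "Suc (length (a' # t))"]] entries_s
    by (simp add: r'_def)
qed

text \<open>The exponent \<open>a'\<close> is an entry of \<open>s\<close> and hence controlled by every operator that controls \<open>s\<close>.\<close>

lemma prec_oadd_omega_of_cases:
  assumes r: "r \<in> OT" and s: "s \<in> OT" and "a \<in> OT" "s \<prec> r \<oplus> omega_of a" "r \<preceq> s"
  obtains (eq) "s = r"
  | (copies) a' n where "a' \<in> OT" "a' \<prec> a" "Eset a' \<subseteq> Eset s" "s \<prec> oadd_copies r a' n"
proof (cases "s = r")
  case False
  with assms obtain a' t where a': "a' \<prec> a"
    and entries_s: "entries s = takeWhile (\<lambda>x. a \<preceq> x) (entries r) @ a' # t"
    by (rule entries_between_oadd_omega_of)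
  have "a' \<in> set (entries s)" using entries_s by simp
  then have "a' \<in> OT" "Eset a' \<subseteq> Eset s"
    using entries_subset_OT[OF s] Union_Eset_entries[of s] by blast+
  then show ?thesis using copies a' prec_oadd_copies[OF r s a' entries_s] by blast
qed (rule eq)

subsection \<open>Nice operators\<close>

locale nice_operator =
  fixes H :: "oterm set \<Rightarrow> oterm set"
  assumes in_OT: "X \<subseteq> OT \<Longrightarrow> H X \<subseteq> OT"
    and extensive: "X \<subseteq> OT \<Longrightarrow> X \<subseteq> H X"
    and closure: "X \<subseteq> OT \<Longrightarrow> Y \<subseteq> OT \<Longrightarrow> X \<subseteq> H Y \<Longrightarrow> H X \<subseteq> H Y"
    and mem_iff_Eset: "X \<subseteq> OT \<Longrightarrow> a \<in> OT \<Longrightarrow> a \<in> H X \<longleftrightarrow> Eset a \<subseteq> H X"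
begin

lemma mono: "X \<subseteq> Y \<Longrightarrow> Y \<subseteq> OT \<Longrightarrow> H X \<subseteq> H Y"
  using closure[of X Y] extensive[of Y] by blast

lemma mem_imp_in_OT: "a \<in> H {} \<Longrightarrow> a \<in> OT"
  using in_OT[of "{}"] by blast

lemma oadd_mem: "X \<subseteq> OT \<Longrightarrow> a \<in> H X \<Longrightarrow> b \<in> H X \<Longrightarrow> a \<oplus> b \<in> H X"
proof -
  assume X: "X \<subseteq> OT" and ab: "a \<in> H X" "b \<in> H X"
  then have OT: "a \<in> OT" "b \<in> OT" using in_OT by blast+
  then have "Eset (a \<oplus> b) \<subseteq> H X"
    using ab mem_iff_Eset[OF X] Eset_oadd_subset[of a b] by blast
  then show "a \<oplus> b \<in> H X" using mem_iff_Eset[OF X oadd_in_OT[OF OT]] by blast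
qed

lemma adjoin_extends: "Z \<subseteq> OT \<Longrightarrow> Y \<subseteq> OT \<Longrightarrow> H Y \<subseteq> adjoin H Z Y"
  unfolding adjoin_def by (rule mono) auto

lemma adjoin_mem_subset: "c \<in> H {} \<Longrightarrow> Y \<subseteq> OT \<Longrightarrow> adjoin H {c} Y \<subseteq> H Y"
  unfolding adjoin_def
  using closure[of "{c} \<union> Y" Y] extensive[of Y] mono[of "{}" Y] mem_imp_in_OT by blast

lemma nice_operator_adjoin:
  assumes "Z \<subseteq> OT"
  shows "nice_operator (adjoin H Z)"
proof
  show "X \<subseteq> adjoin H Z X" if "X \<subseteq> OT" for X
    using that assms extensive[of "Z \<union> X"] by (simp add: adjoin_def)
  show "adjoin H Z X \<subseteq> adjoin H Z Y" if "X \<subseteq> OT" "Y \<subseteq> OT" "X \<subseteq> adjoin H Z Y" for X Y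
    using that assms closure[of "Z \<union> X" "Z \<union> Y"] extensive[of "Z \<union> Y"] by (simp add: adjoin_def)
qed (use assms in_OT mem_iff_Eset in \<open>simp_all add: adjoin_def\<close>)

end

lemma adjoin_empty [simp]: "adjoin H {} = H"
  by (simp add: adjoin_def)

lemma adjoin_adjoin [simp]: "adjoin (adjoin H X) Y = adjoin H (X \<union> Y)"
  by (auto simp: adjoin_def Un_assoc)

locale Th_closed_operator = nice_operator +
  assumes Th_closed: "X \<subseteq> OT \<Longrightarrow> a \<in> H X \<Longrightarrow> a \<prec> Omega_times Om \<Longrightarrow> Th a \<in> H X"
begin

lemma Th_closed_operator_adjoin:
  assumes "Z \<subseteq> OT"
  shows "Th_closed_operator (adjoin H Z)"
proof -
  interpret adjoin: nice_operator "adjoin H Z" by (rule nice_operator_adjoin[OF assms])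
  show ?thesis by standard (use assms Th_closed in \<open>simp add: adjoin_def\<close>)
qed

lemma phibar_mem:
  assumes "a \<in> H {}" "a \<prec> Om" "b \<in> H {}" "b \<prec> Om"
  shows "phibar a b \<in> H {}"
  unfolding phibar_def
proof (rule Th_closed)
  have a: "a \<in> OT" and b: "b \<in> OT" using assms mem_imp_in_OT by auto
  then have "Eset (Omega_times a \<oplus> b) \<subseteq> H {}"
    using assms Eset_Omega_times_oadd[OF a b] mem_iff_Eset[of "{}"] by simp
  then show "Omega_times a \<oplus> b \<in> H {}"
    using a b mem_iff_Eset[of "{}"] Omega_times_oadd_in_OT by simp
  show "Omega_times a \<oplus> b \<prec> Omega_times Om"
    using a b assms by (intro Omega_times_oadd_prec) auto
qed simp

end

lemma Cset_iff_Eset: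
  assumes "x \<in> OT"
  shows "x \<in> Cset a b \<longleftrightarrow> Eset x \<subseteq> Cset a b"
proof
  show "Eset x \<subseteq> Cset a b" if "x \<in> Cset a b"
    using that
  proof (induction rule: Cset.induct)
    case (2 c)
    then have "Eset c \<subseteq> seg b"
      using Eset_subset_OT[of c] Eset_le[of c] prec_order.le_less_trans[of _ c b]
      by (auto simp: seg_def)
    then show ?case using Cset.intros(2) by blast
  next
    case (3 c)
    then show ?case using Cset.intros(3) by auto
  qed auto
  show "x \<in> Cset a b" if "Eset x \<subseteq> Cset a b"
    using assms that
  proof (induction rule: OT_induct)
    case (Sq as)
    then show ?case by (intro Cset.intros(4)) auto
  qed (auto intro: Cset.intros)
qed

lemma Hop_iff:
  "x \<in> Hop \<eta> X \<longleftrightarrow> x \<in> OT \<and>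
    (\<forall>c d. c \<in> OT \<longrightarrow> d \<in> OT \<longrightarrow> \<eta> \<prec> c \<longrightarrow> X \<subseteq> Cset c d \<longrightarrow> x \<in> Cset c d)"
  by (auto simp: Hop_def)

lemma nice_operator_Hop: "nice_operator (Hop \<eta>)"
proof
  fix X Y :: "oterm set" and a
  show "Hop \<eta> X \<subseteq> OT" by (simp add: Hop_def)
  show "X \<subseteq> Hop \<eta> X" if "X \<subseteq> OT" using that by (auto simp: Hop_def)
  show "Hop \<eta> X \<subseteq> Hop \<eta> Y" if X: "X \<subseteq> Hop \<eta> Y"
  proof
    fix x assume x: "x \<in> Hop \<eta> X"
    have "X \<subseteq> Cset c d" if "c \<in> OT" "d \<in> OT" "\<eta> \<prec> c" "Y \<subseteq> Cset c d" for c d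
      using X that by (auto simp: Hop_iff)
    then show "x \<in> Hop \<eta> Y" using x unfolding Hop_iff by simp
  qed
  assume a: "a \<in> OT"
  show "a \<in> Hop \<eta> X \<longleftrightarrow> Eset a \<subseteq> Hop \<eta> X"
    using Cset_iff_Eset[OF a] Eset_subset_OT[OF a] a unfolding Hop_iff subset_iff[of "Eset a"] by blast
qed

lemma Th_closed_operator_Hop:
  assumes "Omega_times Om \<preceq> \<eta>"
  shows "Th_closed_operator (Hop \<eta>)"
proof -
  interpret nice_operator "Hop \<eta>" by (rule nice_operator_Hop)
  show ?thesis
  proof
    fix X a assume a: "a \<in> Hop \<eta> X" "a \<prec> Omega_times Om"
    have "a \<prec> \<eta>" using a(2) assms by (rule prec_order.less_le_trans)
    then have "a \<prec> c" if "\<eta> \<prec> c" for c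
      using that by (rule prec_order.less_trans)
    then show "Th a \<in> Hop \<eta> X" using a(1) unfolding Hop_iff by (simp add: Cset.intros(3))
  qed
qed

subsection \<open>Sentences and their ranks\<close>

lemma neg_neg [simp]: "neg (neg A) = A"
  by (induction A) auto

lemma set_fml_neg [simp]: "set_fml (neg A) = set_fml A"
  by (induction A) auto

lemma fv_neg [simp]: "fv (neg A) = fv A"
  by (induction A) auto

lemma rk_neg [simp]: "rk (neg A) = rk A"
  by (induction A) auto

lemma sentence_neg [simp]: "sentence (neg A) \<longleftrightarrow> sentence A"
  by (simp add: sentence_def)

lemma tfv_tsubst: "tfv r = {} \<Longrightarrow> tfv (tsubst x r t) = tfv t - {x}"
  by (induction t) auto

lemma fv_subst: "tfv r = {} \<Longrightarrow> fv (subst x r A) = fv A - {x}"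
  by (induction A) (auto simp: tfv_tsubst)

lemma set_fml_subst [simp]: "set_fml (subst x r A) = set_fml A"
  by (induction A) auto

lemma rk_subst [simp]: "rk (subst x r A) = rk A"
  by (induction A) auto

lemma fv_map_fml [simp]: "fv (map_fml g A) = fv A"
  by (induction A) auto

lemma tfv_anum [simp]: "tfv (anum n) = {}"
  unfolding anum_def by (induction n) auto

lemma tval_closed: "tfv t = {} \<Longrightarrow> tval e t = tval e' t"
  by (induction t) auto

lemma kset_insert [simp]: "kset (insert A \<Gamma>) = snd ` set_fml A \<union> kset \<Gamma>"
  by (simp add: kset_def)

lemma omax_in_OT: "a \<in> OT \<Longrightarrow> b \<in> OT \<Longrightarrow> omax a b \<in> OT"
  by (simp add: omax_def)

lemma le_omax: "a \<preceq> omax a b" "b \<preceq> omax a b"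
  using prec_order.linear[of a b] by (auto simp: omax_def)

lemma rk_in_OT: "snd ` set_fml A \<subseteq> OT \<Longrightarrow> rk A \<in> OT"
  by (induction A) (simp_all add: image_Un omega_times_in_OT oadd_in_OT omax_in_OT)

context nice_operator
begin

lemma onum_mem: "X \<subseteq> OT \<Longrightarrow> onum n \<in> H X"
  using mem_iff_Eset[of X "onum n"] by simp

lemma omega_times_mem:
  assumes "X \<subseteq> OT" "a \<in> H X"
  shows "omega_times a \<in> H X"
proof -
  have "a \<in> OT" using assms in_OT by blast
  moreover have "Eset (omega_times a) = Eset a" by (simp add: omega_times_eq Eset_omega_pow_times)
  ultimately show ?thesis using assms mem_iff_Eset omega_times_in_OT by metis
qed

lemma rk_mem: "X \<subseteq> OT \<Longrightarrow> snd ` set_fml A \<subseteq> H X \<Longrightarrow> rk A \<in> H X"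
  by (induction A) (simp_all add: image_Un onum_mem omega_times_mem oadd_mem omax_def)

end

lemma sentence_rk_in_OT: "sentence A \<Longrightarrow> rk A \<in> OT"
  by (rule rk_in_OT) (auto simp: sentence_def)

lemma rk_map_fml_prec:
  fixes B :: "'p fml"
  assumes "a \<in> OT" "c \<in> OT" "c \<prec> a"
  shows "rk (map_fml (\<lambda>_. (\<phi>, c)) B) \<prec> omega_times a"
proof -
  have pred: "omega_times c \<prec> omega_times a"
    using assms omega_pow_times_strict_mono by (simp add: omega_times_eq)
  then have zero: "onum 0 \<prec> omega_times a" by (auto simp: onum_0)
  have rk_OT: "rk (map_fml (\<lambda>_. (\<phi>, c)) B) \<in> OT" for B :: "'p fml"
    by (rule rk_in_OT) (use assms in \<open>auto simp: fml.set_map\<close>)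
  have max: "omax x y \<prec> omega_times a" if "x \<prec> omega_times a" "y \<prec> omega_times a" for x y
    using that by (simp add: omax_def)
  show ?thesis
    by (induction B)
      (use assms(1) zero pred rk_OT max oadd_one_prec_omega_times omax_in_OT in simp_all)
qed

lemma disj_of_rk_prec:
  assumes "disj_of A d f" "sentence A" "c \<in> seg d"
  shows "rk (f c) \<prec> rk A"
  using assms(1)
proof cases
  case (3 \<phi> t)
  then show ?thesis using assms rk_map_fml_prec[of d c \<phi>]
    by (auto simp: op_inst_def seg_def sentence_def)
next
  case (4 A' B')
  then have "rk A' \<in> OT" "rk B' \<in> OT"
    using assms(2) by (auto intro!: rk_in_OT simp: sentence_def)
  then have "omax (rk A') (rk B') \<prec> rk A" using prec_oadd_one 4 by (simp add: omax_in_OT)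
  then show ?thesis
    using 4 assms(3) le_omax prec_order.le_less_trans by (metis insertE seg_onum_2 singletonD)
next
  case (5 x A')
  obtain n where "c = onum n" using seg_oomegaE assms(3) 5 by blast
  moreover have "rk A' \<in> OT" using assms(2) 5 by (auto intro!: rk_in_OT simp: sentence_def)
  ultimately show ?thesis using 5 prec_oadd_one by simp
qed (use assms(3) in auto)

lemma disj_of_set_fml:
  assumes "disj_of A d f" "c \<in> seg d"
  shows "snd ` set_fml (f c) \<subseteq> insert c (snd ` set_fml A)"
  using assms(1)
proof cases
  case (5 x A')
  then show ?thesis using seg_oomegaE assms(2) by (metis set_fml_subst fml.set(7) subset_insertI)
qed (use assms(2) in \<open>auto simp: seg_onum_2 op_inst_def fml.set_map\<close>)

lemma disj_of_sentence:
  assumes "disj_of A d f" "sentence A" "c \<in> seg d"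
  shows "sentence (f c)"
  using assms(1)
proof cases
  case (3 \<phi> t)
  then have "operator_form \<phi>" "tfv t = {}" "d \<preceq> Om" using assms(2) by (auto simp: sentence_def)
  moreover from this obtain x where "fv \<phi> = {x}" by (auto simp: operator_form_def)
  moreover have "c \<in> OT" "c \<preceq> Om"
    using assms(3) prec_order.less_le_trans[of c d Om] calculation by (auto simp: seg_def)
  ultimately show ?thesis using 3 assms(3)
    by (auto simp: sentence_def op_inst_def fml.set_map fv_subst)
next
  case (4 A' B')
  then show ?thesis using assms by (auto simp: sentence_def seg_onum_2)
next
  case (5 x A')
  obtain n where "c = onum n" using seg_oomegaE assms(3) 5 by blast
  then show ?thesis using 5 assms(2) by (auto simp: sentence_def fv_subst)
qed (use assms(3) in auto)

inductive_cases disj_of_EqE: "disj_of (Eq s t) d f"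
inductive_cases disj_of_NeqE: "disj_of (Neq s t) d f"
inductive_cases disj_of_PredE: "disj_of (Pred p t) d f"
inductive_cases disj_of_NPredE: "disj_of (NPred p t) d f"
inductive_cases disj_of_OrE: "disj_of (Or A B) d f"
inductive_cases disj_of_AndE: "disj_of (And A B) d f"
inductive_cases disj_of_ExE: "disj_of (Ex x A) d f"
inductive_cases disj_of_AllE: "disj_of (All x A) d f"

lemmas disj_of_fmlE =
  disj_of_EqE disj_of_NeqE disj_of_PredE disj_of_NPredE
  disj_of_OrE disj_of_AndE disj_of_ExE disj_of_AllE

lemma disj_of_unique:
  assumes "disj_of A d f" "disj_of A d' g"
  shows "d = d'" "\<And>c. c \<in> seg d \<Longrightarrow> f c = g c"
proof -
  have "d = d' \<and> (\<forall>c\<in>seg d. f c = g c)"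
    using assms(1)
  proof cases
    case (5 x A')
    have "f c = g c" if "c \<in> seg oomega" for c
    proof -
      from that obtain n where "c = onum n" by (rule seg_oomegaE)
      then show ?thesis using 5 assms(2) by (auto elim!: disj_of_ExE)
    qed
    then show ?thesis using 5 assms(2) by (auto elim!: disj_of_ExE)
  qed (use assms(2) in \<open>auto elim!: disj_of_fmlE simp: seg_onum_2\<close>)
  then show "d = d'" "\<And>c. c \<in> seg d \<Longrightarrow> f c = g c" by auto
qed

lemma not_disj_of_neg: "disj_of A d f \<Longrightarrow> \<not> disj_of (neg A) d' g"
  by (induction rule: disj_of.induct) (auto elim!: disj_of_fmlE)

lemma disj_of_equation:
  assumes "tfv s = {}" "tfv t = {}"
  shows "\<exists>d f. disj_of (Eq s t) d f \<or> disj_of (Neq s t) d f"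
proof (cases "tval (\<lambda>_. 0) s = tval (\<lambda>_. 0) t")
  case True
  then have "tval e s = tval e t" for e
    using assms tval_closed[of s e "\<lambda>_. 0"] tval_closed[of t e "\<lambda>_. 0"] by simp
  then show ?thesis using disj_of.intros(2) by blast
next
  case False
  then have "tval e s \<noteq> tval e t" for e
    using assms tval_closed[of s e "\<lambda>_. 0"] tval_closed[of t e "\<lambda>_. 0"] by simp
  then show ?thesis using disj_of.intros(1) by blast
qed

lemma sentence_disj_of_cases:
  assumes "sentence A"
  shows "\<exists>d f. disj_of A d f \<or> disj_of (neg A) d f"
proof -
  have Pred: "\<exists>d f. disj_of (Pred p t) d f" for p t
    using disj_of.intros(3)[of "snd p" "op_inst (fst p) t" "fst p" t] by (cases p) auto
  have Or: "\<exists>d f. disj_of (Or B C) d f" for B C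
    using disj_of.intros(4)[of "\<lambda>c. if c = onum 0 then B else C", OF refl refl] by auto
  have Ex: "\<exists>d f. disj_of (Ex x B) d f" for x B
    using disj_of.intros(5)[of "\<lambda>c. subst x (anum (inv onum c)) B" x B] inv_f_f[of onum]
    by (auto simp: inj_def)
  have "tfv s = {} \<and> tfv t = {}" if "A = Eq s t \<or> A = Neq s t" for s t
    using that assms by (auto simp: sentence_def)
  then show ?thesis
    by (cases A)
      (simp_all add: ex_disj_distrib Pred Or Ex disj_of_equation[unfolded ex_disj_distrib] disj_commute)
qed

subsection \<open>Derivations\<close>

text \<open>
  A single inference with principal formulas \<open>P\<close>, where \<open>D H' \<alpha>' B\<close> stands for the premise with operator
  \<open>H'\<close>, height \<open>\<alpha>'\<close> and side formula \<open>B\<close>.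
\<close>

inductive inference ::
  "oterm \<Rightarrow> ((oterm set \<Rightarrow> oterm set) \<Rightarrow> oterm \<Rightarrow> idfml \<Rightarrow> bool) \<Rightarrow>
    (oterm set \<Rightarrow> oterm set) \<Rightarrow> oterm \<Rightarrow> idfml set \<Rightarrow> bool"
  for \<rho> D H \<alpha> where
  Conj: "conj_of A d f \<Longrightarrow> (\<And>c. c \<in> seg d \<Longrightarrow> \<exists>\<alpha>'\<in>seg \<alpha>. D (adjoin H {c}) \<alpha>' (f c)) \<Longrightarrow>
     inference \<rho> D H \<alpha> {A}"
| Disj: "disj_of A d f \<Longrightarrow> c \<in> seg d \<Longrightarrow> c \<prec> \<alpha> \<Longrightarrow> c \<in> H {} \<Longrightarrow> \<alpha>' \<in> seg \<alpha> \<Longrightarrow> D H \<alpha>' (f c) \<Longrightarrow>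
     inference \<rho> D H \<alpha> {A}"
| Cut: "sentence A \<Longrightarrow> rk A \<prec> \<rho> \<Longrightarrow> \<alpha>' \<in> seg \<alpha> \<Longrightarrow> D H \<alpha>' A \<Longrightarrow> D H \<alpha>' (neg A) \<Longrightarrow>
     inference \<rho> D H \<alpha> {}"
| Fix: "Om \<preceq> \<alpha> \<Longrightarrow> \<alpha>' \<in> seg \<alpha> \<Longrightarrow> D H \<alpha>' (op_inst \<phi> t Om) \<Longrightarrow>
     inference \<rho> D H \<alpha> {Pred (\<phi>, Om) t}"

lemma deriv_inferenceI:
  assumes "insert \<alpha> (kset \<Gamma>) \<subseteq> H {}" "P \<subseteq> \<Gamma>"
    and "inference \<rho> (\<lambda>H' \<alpha>' B. deriv \<rho> H' \<alpha>' (insert B \<Gamma>)) H \<alpha> P"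
  shows "deriv \<rho> H \<alpha> \<Gamma>"
  using assms(3)
proof cases
  case (Conj A d f)
  then show ?thesis using assms(1,2) by (intro deriv.Conj[of \<alpha> \<Gamma> H A d f]) auto
next
  case (Disj A d f c \<alpha>')
  then show ?thesis using assms(1,2) by (intro deriv.Disj[of \<alpha> \<Gamma> H A d f c \<alpha>']) auto
next
  case (Cut A \<alpha>')
  then show ?thesis using assms(1) by (intro deriv.Cut[of \<alpha> \<Gamma> H A \<rho> \<alpha>']) auto
next
  case (Fix \<alpha>' \<phi> t)
  then show ?thesis using assms(1,2) by (intro deriv.Fix[of \<alpha> \<Gamma> H \<phi> t \<alpha>']) auto
qed

lemma deriv_induct [consumes 1, case_names inference]:
  assumes "deriv \<rho> H \<alpha> \<Gamma>"
    and step: "\<And>H \<alpha> \<Gamma> P. insert \<alpha> (kset \<Gamma>) \<subseteq> H {} \<Longrightarrow> P \<subseteq> \<Gamma> \<Longrightarrow>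
      inference \<rho> (\<lambda>H' \<alpha>' B. deriv \<rho> H' \<alpha>' (insert B \<Gamma>) \<and> Q H' \<alpha>' (insert B \<Gamma>)) H \<alpha> P \<Longrightarrow> Q H \<alpha> \<Gamma>"
  shows "Q H \<alpha> \<Gamma>"
  using assms(1)
proof (induction rule: deriv.induct)
  case (Conj \<alpha> \<Gamma> H A d f)
  then show ?case by (intro step[of \<alpha> \<Gamma> H "{A}"] inference.Conj) auto
next
  case (Disj \<alpha> \<Gamma> H A d f c \<alpha>')
  then show ?case by (intro step[of \<alpha> \<Gamma> H "{A}"] inference.Disj) auto
next
  case (Cut \<alpha> \<Gamma> H A \<alpha>')
  then show ?case by (intro step[of \<alpha> \<Gamma> H "{}"] inference.Cut) auto
next
  case (Fix \<alpha> \<Gamma> H \<phi> t \<alpha>')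
  then show ?case by (intro step[of \<alpha> \<Gamma> H "{Pred (\<phi>, Om) t}"] inference.Fix) auto
qed

lemma deriv_control:
  assumes "deriv \<rho> H \<alpha> \<Gamma>"
  shows "\<alpha> \<in> H {}" "kset \<Gamma> \<subseteq> H {}"
  using assms by (cases; auto)+

lemma deriv_cutI:
  assumes "sentence A" "rk A \<prec> \<rho>" "\<gamma> \<in> seg \<beta>" "\<beta> \<in> H {}"
    and pos: "deriv \<rho> H \<gamma> (insert A \<Gamma>)" and neg: "deriv \<rho> H \<gamma> (insert (neg A) \<Gamma>)"
  shows "deriv \<rho> H \<beta> \<Gamma>"
proof (rule deriv.Cut[OF _ assms(1-3)])
  show "{\<beta>} \<union> kset \<Gamma> \<subseteq> H {}" using assms(4) deriv_control(2)[OF pos] by simp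
qed (use pos neg in simp_all)

lemma inference_map:
  assumes "inference \<rho> D H \<alpha> P" "\<rho> \<preceq> \<rho>'" "\<alpha> \<preceq> \<beta>" "H {} \<subseteq> H' {}"
    and height: "\<And>\<alpha>'. \<alpha>' \<in> seg \<alpha> \<Longrightarrow> h \<alpha>' \<in> seg \<beta>"
    and premise: "\<And>Z \<alpha>' B. Z \<subseteq> OT \<Longrightarrow> \<alpha>' \<in> seg \<alpha> \<Longrightarrow> D (adjoin H Z) \<alpha>' B \<Longrightarrow> D' (adjoin H' Z) (h \<alpha>') B"
  shows "inference \<rho>' D' H' \<beta> P"
proof -
  have premise_empty: "D' H' (h \<alpha>') B" if "\<alpha>' \<in> seg \<alpha>" "D H \<alpha>' B" for \<alpha>' B
    using premise[of "{}" \<alpha>' B] that by simp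
  show ?thesis
    using assms(1)
  proof cases
    case (Conj A d f)
    have "\<exists>\<beta>'\<in>seg \<beta>. D' (adjoin H' {c}) \<beta>' (f c)" if "c \<in> seg d" for c
      using Conj(3)[OF that] height premise[of "{c}"] that by (auto simp: seg_def)
    then show ?thesis using Conj by (auto intro: inference.Conj)
  next
    case (Disj A d f c \<alpha>')
    then show ?thesis
      using inference.Disj[of A d f c \<beta> H' "h \<alpha>'" D' \<rho>'] height premise_empty assms(4)
        prec_order.less_le_trans[OF _ assms(3)] by blast
  next
    case (Cut A \<alpha>')
    then show ?thesis
      using inference.Cut[of A \<rho>' "h \<alpha>'" \<beta> D' H'] height premise_empty
        prec_order.less_le_trans[OF _ assms(2)] by blast
  next
    case (Fix \<alpha>' \<phi> t)
    then show ?thesis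
      using inference.Fix[of \<beta> "h \<alpha>'" D' H' \<phi> t \<rho>'] height premise_empty
        prec_order.order_trans[OF _ assms(3)] by blast
  qed
qed

lemma deriv_inference_mapI:
  assumes "inference \<rho> D H \<alpha> P" "\<rho> \<preceq> \<rho>'" "\<alpha> \<preceq> \<beta>" "H {} \<subseteq> H' {}"
    and "\<And>\<alpha>'. \<alpha>' \<in> seg \<alpha> \<Longrightarrow> h \<alpha>' \<in> seg \<beta>"
    and "\<And>Z \<alpha>' B. Z \<subseteq> OT \<Longrightarrow> \<alpha>' \<in> seg \<alpha> \<Longrightarrow> D (adjoin H Z) \<alpha>' B \<Longrightarrow>
      deriv \<rho>' (adjoin H' Z) (h \<alpha>') (insert B \<Gamma>)"
    and "P \<subseteq> \<Gamma>" "insert \<beta> (kset \<Gamma>) \<subseteq> H' {}"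
  shows "deriv \<rho>' H' \<beta> \<Gamma>"
  using assms(7,8) inference_map[where D' = "\<lambda>H \<alpha> B. deriv \<rho>' H \<alpha> (insert B \<Gamma>)", OF assms(1-6)]
  by (intro deriv_inferenceI)

lemma seg_mono: "a \<preceq> b \<Longrightarrow> seg a \<subseteq> seg b"
  using prec_order.less_le_trans[of _ a b] by (auto simp: seg_def)

lemma seg_prec_trans: "a \<in> seg b \<Longrightarrow> b \<preceq> c \<Longrightarrow> a \<prec> c"
  using prec_order.less_le_trans[of a b c] by (simp add: seg_def)

lemma deriv_weaken:
  assumes "deriv \<rho> H \<alpha> \<Gamma>" "nice_operator H'" "\<And>Y. Y \<subseteq> OT \<Longrightarrow> H Y \<subseteq> H' Y"
    and "\<rho> \<preceq> \<rho>'" "\<alpha> \<preceq> \<alpha>'" "\<Gamma> \<subseteq> \<Gamma>'" "insert \<alpha>' (kset \<Gamma>') \<subseteq> H' {}"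
  shows "deriv \<rho>' H' \<alpha>' \<Gamma>'"
  using assms(1-3,5-)
proof (induction arbitrary: H' \<alpha>' \<Gamma>' rule: deriv_induct)
  case (inference H \<alpha> \<Gamma> P)
  interpret nice_operator H' by fact
  from inference.IH assms(4) inference.prems(3) show ?case
  proof (rule deriv_inference_mapI[where h = "\<lambda>\<beta>. \<beta>"],
      goal_cases operator height premise principal control)
    case (premise Z \<beta> B)
    then have IH: "deriv \<rho>' H'' \<beta> \<Gamma>''"
      if "nice_operator H''" "\<And>Y. Y \<subseteq> OT \<Longrightarrow> adjoin H Z Y \<subseteq> H'' Y" "insert B \<Gamma> \<subseteq> \<Gamma>''"
        "insert \<beta> (kset \<Gamma>'') \<subseteq> H'' {}" for H'' \<Gamma>''
      using that by blast
    have le: "adjoin H Z Y \<subseteq> adjoin H' Z Y" if "Y \<subseteq> OT" for Y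
      using that premise(1) inference.prems(2)[of "Z \<union> Y"] by (simp add: adjoin_def)
    show ?case
    proof (rule IH[OF nice_operator_adjoin[OF premise(1)] le])
      have "insert \<beta> (kset (insert B \<Gamma>)) \<subseteq> adjoin H' Z {}"
        using premise(3) deriv_control[of \<rho> "adjoin H Z" \<beta> "insert B \<Gamma>"] le[of "{}"] by blast
      moreover have "kset \<Gamma>' \<subseteq> adjoin H' Z {}"
        using inference.prems(5) adjoin_extends[OF premise(1), of "{}"] by blast
      ultimately show "insert \<beta> (kset (insert B \<Gamma>')) \<subseteq> adjoin H' Z {}" by simp
    qed (use inference.prems(4) in auto)
  qed (use inference.prems(2)[of "{}"] inference.hyps(2) inference.prems(4,5)
      seg_mono[OF inference.prems(3)] in auto)
qed

context nice_operator
begin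

lemma kset_neg_disj_of:
  assumes "disj_of C d f" "c \<in> seg d" "kset (insert C \<Gamma>) \<subseteq> H {}"
  shows "kset (insert (neg (f c)) \<Gamma>) \<subseteq> adjoin H {c} {}"
proof -
  have c: "{c} \<subseteq> OT" using assms(2) by (simp add: seg_def)
  have "kset (insert (neg (f c)) \<Gamma>) \<subseteq> insert c (kset (insert C \<Gamma>))"
    using disj_of_set_fml[OF assms(1,2)] unfolding kset_insert set_fml_neg by blast
  moreover have "c \<in> adjoin H {c} {}" using extensive[OF c] by (simp add: adjoin_def)
  ultimately show ?thesis using assms(3) adjoin_extends[OF c, of "{}"] by blast
qed

lemma deriv_adjoin_insert:
  assumes "deriv \<rho> H \<alpha> \<Gamma>" "Z \<subseteq> OT" "snd ` set_fml B \<subseteq> adjoin H Z {}"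
  shows "deriv \<rho> (adjoin H Z) \<alpha> (insert B \<Gamma>)"
proof (rule deriv_weaken[OF assms(1) nice_operator_adjoin[OF assms(2)] adjoin_extends[OF assms(2)]])
  show "insert \<alpha> (kset (insert B \<Gamma>)) \<subseteq> adjoin H Z {}"
    using deriv_control[OF assms(1)] adjoin_extends[OF assms(2), of "{}"] assms(3)
    unfolding kset_insert by blast
qed auto

lemma deriv_raise_height:
  assumes "deriv \<rho> H \<alpha> \<Gamma>" "\<alpha> \<preceq> \<beta>" "\<beta> \<in> H {}"
  shows "deriv \<rho> H \<beta> \<Gamma>"
  by (rule deriv_weaken[OF assms(1) nice_operator_axioms])
    (use assms deriv_control[OF assms(1)] in auto)

lemma deriv_raise_rank:
  assumes "deriv \<rho> H \<alpha> \<Gamma>" "\<rho> \<preceq> \<rho>'"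
  shows "deriv \<rho>' H \<alpha> \<Gamma>"
  by (rule deriv_weaken[OF assms(1) nice_operator_axioms _ assms(2)])
    (use deriv_control[OF assms(1)] in auto)

end

lemma inference_conjE:
  assumes "inference \<rho> D H \<alpha> P" "neg C \<in> P" "disj_of C d f" "c \<in> seg d"
  obtains \<alpha>' where "\<alpha>' \<in> seg \<alpha>" "D (adjoin H {c}) \<alpha>' (neg (f c))"
  using assms(1)
proof cases
  case (Conj A d' g)
  then have "conj_of (neg C) d' g" using assms(2) by simp
  then obtain g' where g: "g = (\<lambda>c. neg (g' c))" "disj_of C d' g'"
    by cases (metis neg_neg)
  then have "d' = d" "g c = neg (f c)" using disj_of_unique[OF assms(3) g(2)] assms(4) by auto
  then show ?thesis using Conj(3)[of c] assms(4) that by auto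
next
  case (Disj A d' g b \<alpha>')
  then show ?thesis using assms(2) not_disj_of_neg[OF assms(3)] by blast
next
  case (Fix \<alpha>' \<phi> t)
  then have "C = NPred (\<phi>, Om) t" using assms(2) by (metis neg.simps(3) neg_neg singletonD)
  then show ?thesis using assms(3) by (auto elim: disj_of_NPredE)
qed (use assms(2) in simp)

lemma inference_disjE:
  assumes "inference \<rho> D H \<alpha> P" "C \<in> P" "disj_of C d f" "\<alpha> \<prec> Om"
  obtains c \<alpha>' where "c \<in> seg d" "c \<prec> \<alpha>" "c \<in> H {}" "\<alpha>' \<in> seg \<alpha>" "D H \<alpha>' (f c)"
  using assms(1)
proof cases
  case (Conj A d' g)
  then have "conj_of C d' g" using assms(2) by simp
  then obtain g' where "disj_of (neg C) d' g'" by cases (metis neg_neg)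
  then show ?thesis using not_disj_of_neg[OF assms(3)] by blast
next
  case (Disj A d' g c \<alpha>')
  then have "disj_of C d' g" using assms(2) by simp
  then show ?thesis using that Disj disj_of_unique[OF assms(3)] by metis
next
  case (Fix \<alpha>' \<phi> t)
  then show ?thesis using assms(4) prec_order.not_less by blast
qed (use assms(2) in simp)

lemma inversion:
  assumes "deriv \<rho> H \<alpha> \<Delta>" "nice_operator H" "\<Delta> \<subseteq> insert (neg C) \<Gamma>" "kset (insert C \<Gamma>) \<subseteq> H {}"
    and C: "disj_of C d f" and c: "c \<in> seg d"
  shows "deriv \<rho> (adjoin H {c}) \<alpha> (insert (neg (f c)) \<Gamma>)"
  using assms(1-4)
proof (induction arbitrary: \<Gamma> rule: deriv_induct)
  case (inference H \<alpha> \<Delta> P)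
  interpret nice_operator H by fact
  have c_OT: "{c} \<subseteq> OT" using c by (simp add: seg_def)
  interpret adjoin_c: nice_operator "adjoin H {c}" by (rule nice_operator_adjoin[OF c_OT])
  have extends: "H {} \<subseteq> adjoin H {c} {}" using adjoin_extends[OF c_OT, of "{}"] by simp
  have control: "insert \<alpha> (kset (insert (neg (f c)) \<Gamma>)) \<subseteq> adjoin H {c} {}"
    using inference.hyps(1) extends kset_neg_disj_of[OF C c inference.prems(3)] by blast
  show ?case
  proof (cases "neg C \<in> P")
    case True
    obtain \<alpha>' where less: "\<alpha>' \<in> seg \<alpha>"
      and IH: "\<And>\<Gamma>'. insert (neg (f c)) \<Delta> \<subseteq> insert (neg C) \<Gamma>' \<Longrightarrow> kset (insert C \<Gamma>') \<subseteq> adjoin H {c} {} \<Longrightarrow>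
        deriv \<rho> (adjoin (adjoin H {c}) {c}) \<alpha>' (insert (neg (f c)) \<Gamma>')"
      using inference_conjE[OF inference.IH True C c] adjoin_c.nice_operator_axioms by metis
    have "deriv \<rho> (adjoin (adjoin H {c}) {c}) \<alpha>' (insert (neg (f c)) (insert (neg (f c)) \<Gamma>))"
      by (rule IH) (use inference.prems(2,3) control extends in auto)
    then have "deriv \<rho> (adjoin H {c}) \<alpha>' (insert (neg (f c)) \<Gamma>)" by simp
    then show ?thesis
      by (rule adjoin_c.deriv_raise_height) (use less control in \<open>auto simp: seg_def\<close>)
  next
    case False
    from inference.IH show ?thesis
    proof (rule deriv_inference_mapI[where h = "\<lambda>\<beta>. \<beta>"],
        goal_cases rank bound operator height premise principal control)
      case (premise Z \<beta> B)
      note IH = premise(3)[THEN conjunct2, rule_format]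
      have "kset (insert B \<Delta>) \<subseteq> adjoin H Z {}"
        using premise(3)[THEN conjunct1] by (rule deriv_control(2))
      then have "kset (insert C (insert B \<Gamma>)) \<subseteq> adjoin H Z {}"
        using inference.prems(3) adjoin_extends[OF premise(1), of "{}"] unfolding kset_insert by blast
      then have "deriv \<rho> (adjoin (adjoin H Z) {c}) \<beta> (insert (neg (f c)) (insert B \<Gamma>))"
        using inference.prems(2) by (intro IH[OF nice_operator_adjoin[OF premise(1)]]) auto
      then show ?case by (simp add: insert_commute)
    qed (use extends control False inference.hyps(2) inference.prems(2) in auto)
  qed
qed

lemma (in nice_operator) cut_with_inversion:
  assumes C: "disj_of C d f" "sentence C" "rk C \<preceq> \<rho>" and c: "c \<in> seg d" "c \<in> H {}"
    and neg: "deriv \<rho> H \<epsilon> (insert (neg C) \<Gamma>)" and pos: "deriv \<rho> H \<gamma> (insert (f c) \<Gamma>)"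
    and \<epsilon>_le: "\<epsilon> \<preceq> \<gamma>" and heights: "\<gamma> \<in> seg \<beta>" "\<beta> \<in> H {}"
  shows "deriv \<rho> H \<beta> \<Gamma>"
proof (rule deriv_cutI[OF disj_of_sentence[OF C(1,2) c(1)] _ heights pos])
  show "rk (f c) \<prec> \<rho>"
    using disj_of_rk_prec[OF C(1,2) c(1)] C(3) by (rule prec_order.less_le_trans)
  have "deriv \<rho> (adjoin H {c}) \<epsilon> (insert (neg (f c)) \<Gamma>)"
    by (rule inversion[OF neg nice_operator_axioms subset_refl _ C(1) c(1)])
      (use deriv_control(2)[OF neg] in simp)
  then show "deriv \<rho> H \<gamma> (insert (neg (f c)) \<Gamma>)"
    by (rule deriv_weaken[OF _ nice_operator_axioms adjoin_mem_subset[OF c(2)]])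
      (use \<epsilon>_le deriv_control[OF pos] in auto)
qed

definition reducible ::
  "oterm \<Rightarrow> idfml \<Rightarrow> oterm \<Rightarrow> (oterm set \<Rightarrow> oterm set) \<Rightarrow> oterm \<Rightarrow> idfml set \<Rightarrow> bool" where
  "reducible \<rho> C \<epsilon> H \<beta> \<Delta> \<longleftrightarrow> (\<forall>\<Gamma>. \<Delta> \<subseteq> insert C \<Gamma> \<longrightarrow>
    deriv \<rho> H \<epsilon> (insert (neg C) \<Gamma>) \<longrightarrow> deriv \<rho> H (\<epsilon> \<oplus> \<beta>) \<Gamma>)"

lemma (in nice_operator) reducible_adjoinD:
  assumes "reducible \<rho> C \<epsilon> (adjoin H Z) \<beta> (insert B \<Delta>)" and Z: "Z \<subseteq> OT"
    and "deriv \<rho> (adjoin H Z) \<beta> (insert B \<Delta>)" "\<Delta> \<subseteq> insert C \<Gamma>"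
    and neg: "deriv \<rho> H \<epsilon> (insert (neg C) \<Gamma>)"
  shows "deriv \<rho> (adjoin H Z) (\<epsilon> \<oplus> \<beta>) (insert B \<Gamma>)"
proof -
  have "deriv \<rho> (adjoin H Z) \<epsilon> (insert (neg C) (insert B \<Gamma>))"
    using deriv_adjoin_insert[OF neg Z, of B] deriv_control(2)[OF assms(3)]
    by (simp add: insert_commute)
  moreover have "insert B \<Delta> \<subseteq> insert C (insert B \<Gamma>)" using assms(4) by auto
  ultimately show ?thesis using assms(1) unfolding reducible_def by blast
qed

text \<open>The bound \<open>\<beta> \<prec> \<Omega>\<close> excludes the rule (Fix), whose principal formula could be \<open>C\<close>.\<close>

lemma deriv_imp_reducible:
  assumes "deriv \<rho> H \<beta> \<Delta>" "nice_operator H" "\<beta> \<prec> Om"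
    and C: "disj_of C d f" "sentence C" "rk C \<preceq> \<rho>"
  shows "reducible \<rho> C \<epsilon> H \<beta> \<Delta>"
  using assms(1-3)
proof (induction rule: deriv_induct)
  case (inference H \<beta> \<Delta> P)
  interpret nice_operator H by fact
  show ?case
    unfolding reducible_def
  proof (intro allI impI)
    fix \<Gamma> assume sub: "\<Delta> \<subseteq> insert C \<Gamma>" and neg: "deriv \<rho> H \<epsilon> (insert (neg C) \<Gamma>)"
    have OT: "\<epsilon> \<in> OT" "\<beta> \<in> OT" using deriv_control(1)[OF neg] inference.hyps(1) mem_imp_in_OT by auto
    have control: "insert (\<epsilon> \<oplus> \<beta>) (kset \<Gamma>) \<subseteq> H {}"
      using deriv_control[OF neg] inference.hyps(1) oadd_mem[of "{}"] by simp
    have premise: "deriv \<rho> (adjoin H Z) (\<epsilon> \<oplus> \<gamma>) (insert B \<Gamma>)"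
      if "Z \<subseteq> OT" "\<gamma> \<in> seg \<beta>" "deriv \<rho> (adjoin H Z) \<gamma> (insert B \<Delta>) \<and>
          (nice_operator (adjoin H Z) \<longrightarrow> \<gamma> \<prec> Om \<longrightarrow> reducible \<rho> C \<epsilon> (adjoin H Z) \<gamma> (insert B \<Delta>))"
      for Z \<gamma> B
    proof (rule reducible_adjoinD[OF _ that(1) that(3)[THEN conjunct1] sub neg])
      show "reducible \<rho> C \<epsilon> (adjoin H Z) \<gamma> (insert B \<Delta>)"
        using that nice_operator_adjoin[OF that(1)] seg_prec_trans[OF that(2), of Om] inference.prems(2)
        by simp
    qed
    show "deriv \<rho> H (\<epsilon> \<oplus> \<beta>) \<Gamma>"
    proof (cases "C \<in> P")
      case True
      obtain c \<gamma> where c: "c \<in> seg d" "c \<in> H {}" and \<gamma>: "\<gamma> \<in> seg \<beta>"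
        and IH: "deriv \<rho> H \<gamma> (insert (f c) \<Delta>) \<and>
          (nice_operator H \<longrightarrow> \<gamma> \<prec> Om \<longrightarrow> reducible \<rho> C \<epsilon> H \<gamma> (insert (f c) \<Delta>))"
        using inference_disjE[OF inference.IH True C(1) inference.prems(2)] by blast
      have "deriv \<rho> H (\<epsilon> \<oplus> \<gamma>) (insert (f c) \<Gamma>)"
        using premise[of "{}" \<gamma> "f c"] \<gamma> IH by simp
      moreover have "\<epsilon> \<preceq> \<epsilon> \<oplus> \<gamma>" using OT(1) \<gamma> by (intro oadd_ge_left) (auto simp: seg_def)
      ultimately show ?thesis
        by (rule cut_with_inversion[OF C c neg _ _ oadd_in_seg[OF OT \<gamma>]]) (use control in simp)
    next
      case False
      show ?thesis
        by (rule deriv_inference_mapI[where h = "\<lambda>\<gamma>. \<epsilon> \<oplus> \<gamma>",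
              OF inference.IH _ _ _ oadd_in_seg[OF OT] premise])
          (use oadd_ge_right OT control False inference.hyps(2) sub in auto)
    qed
  qed
qed

lemma (in nice_operator) cut_reduction:
  assumes "sentence A" "rk A \<preceq> \<rho>" "\<epsilon> \<prec> Om"
    and "deriv \<rho> H \<epsilon> (insert A \<Gamma>)" "deriv \<rho> H \<epsilon> (insert (neg A) \<Gamma>)"
  shows "deriv \<rho> H (\<epsilon> \<oplus> \<epsilon>) \<Gamma>"
proof -
  obtain C d f where C: "disj_of C d f" and "C = A \<or> C = neg A"
    using sentence_disj_of_cases[OF assms(1)] by blast
  then have "sentence C" "rk C \<preceq> \<rho>" and pos: "deriv \<rho> H \<epsilon> (insert C \<Gamma>)"
    and neg: "deriv \<rho> H \<epsilon> (insert (neg C) \<Gamma>)"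
    using assms by auto
  then have "reducible \<rho> C \<epsilon> H \<epsilon> (insert C \<Gamma>)"
    using deriv_imp_reducible[OF pos nice_operator_axioms assms(3) C] by blast
  then show ?thesis using neg unfolding reducible_def by blast
qed

subsection \<open>Predicative cut elimination\<close>

definition cut_elim_at :: "oterm \<Rightarrow> bool" where
  "cut_elim_at \<alpha> \<longleftrightarrow> (\<forall>\<rho> H \<beta> \<Gamma>. \<rho> \<in> OT \<longrightarrow> \<rho> \<prec> Om \<longrightarrow> Th_closed_operator H \<longrightarrow> \<alpha> \<in> H {} \<longrightarrow> \<beta> \<prec> Om \<longrightarrow>
    deriv (\<rho> \<oplus> omega_of \<alpha>) H \<beta> \<Gamma> \<longrightarrow> deriv \<rho> H (phibar \<alpha> \<beta>) \<Gamma>)"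

lemma inference_cut_cases:
  assumes "inference \<rho>' D H \<alpha> P"
  obtains (small) "inference \<rho> D H \<alpha> P"
  | (large) A \<alpha>' where "sentence A" "\<rho> \<preceq> rk A" "rk A \<prec> \<rho>'" "\<alpha>' \<in> seg \<alpha>" "D H \<alpha>' A" "D H \<alpha>' (neg A)"
  using assms
proof cases
  case (Conj A d f)
  then show ?thesis using small inference.Conj by metis
next
  case (Cut A \<alpha>')
  then show ?thesis using small large inference.Cut prec_order.not_less by metis
qed (use small in \<open>auto intro: inference.Disj inference.Fix\<close>)

context Th_closed_operator
begin

context
  fixes \<alpha> \<beta> :: oterm
  assumes \<alpha>: "\<alpha> \<in> H {}" "\<alpha> \<prec> Om" and \<beta>: "\<beta> \<in> H {}" "\<beta> \<prec> Om"
begin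

lemma deriv_phibarI: "deriv \<rho> H \<delta> \<Gamma> \<Longrightarrow> \<delta> \<prec> phibar \<alpha> \<beta> \<Longrightarrow> deriv \<rho> H (phibar \<alpha> \<beta>) \<Gamma>"
  using deriv_raise_height phibar_mem[OF \<alpha> \<beta>] by blast

lemma deriv_oadd_copies_phibar:
  assumes "cut_elim_at a" "a \<in> H {}" "a \<prec> \<alpha>" and \<rho>: "\<rho> \<in> OT" "\<rho> \<prec> Om"
    and "deriv (oadd_copies \<rho> a n) H \<delta> \<Gamma>" "\<delta> \<prec> phibar \<alpha> \<beta>"
  shows "deriv \<rho> H (phibar \<alpha> \<beta>) \<Gamma>"
  using assms(6,7)
proof (induction n arbitrary: \<delta>)
  case 0
  then show ?case using deriv_phibarI by simp
next
  case (Suc n)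
  have OT: "a \<in> OT" "\<delta> \<in> OT" "\<alpha> \<in> OT" "\<beta> \<in> OT"
    using assms(2) deriv_control(1)[OF Suc.prems(1)] \<alpha> \<beta> mem_imp_in_OT by auto
  have "a \<prec> Om" using assms(3) \<alpha>(2) by (rule prec_order.less_trans)
  have "\<delta> \<prec> Om" using Suc.prems(2) phibar_prec_Om by (rule prec_order.less_trans)
  have "oadd_copies \<rho> a n \<in> OT" "oadd_copies \<rho> a n \<prec> Om"
    using OT \<rho> \<open>a \<prec> Om\<close> oadd_copies_in_OT oadd_copies_prec_Om by auto
  then have "deriv (oadd_copies \<rho> a n) H (phibar a \<delta>) \<Gamma>"
    using assms(1,2) Suc.prems(1) \<open>\<delta> \<prec> Om\<close> Th_closed_operator_axioms by (simp add: cut_elim_at_def)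
  moreover have "phibar a \<delta> \<prec> phibar \<alpha> \<beta>"
    using phibar_closed[OF OT(3) \<alpha>(2) OT(4) \<beta>(2) OT(1) assms(3) OT(2) Suc.prems(2)] .
  ultimately show ?case by (rule Suc.IH)
qed

lemma large_cut_elim:
  assumes IH: "\<And>a. a \<in> OT \<Longrightarrow> a \<prec> \<alpha> \<Longrightarrow> cut_elim_at a"
    and \<rho>: "\<rho> \<in> OT" "\<rho> \<prec> Om" and A: "sentence A" "\<rho> \<preceq> rk A" "rk A \<prec> \<rho> \<oplus> omega_of \<alpha>"
    and \<epsilon>: "\<epsilon> \<prec> phibar \<alpha> \<beta>"
    and pos: "deriv \<rho> H \<epsilon> (insert A \<Gamma>)" and neg: "deriv \<rho> H \<epsilon> (insert (neg A) \<Gamma>)"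
  shows "deriv \<rho> H (phibar \<alpha> \<beta>) \<Gamma>"
proof -
  have control: "\<epsilon> \<in> H {}" "snd ` set_fml A \<subseteq> H {}"
    using deriv_control[OF pos] by auto
  have \<epsilon>_OT: "\<epsilon> \<in> OT" using control(1) mem_imp_in_OT by blast
  have "\<alpha> \<in> OT" using \<alpha>(1) mem_imp_in_OT by blast
  from \<rho>(1) sentence_rk_in_OT[OF A(1)] this A(3,2) show ?thesis
  proof (cases rule: prec_oadd_omega_of_cases)
    case eq
    have "\<epsilon> \<prec> Om" using \<epsilon> phibar_prec_Om by (rule prec_order.less_trans)
    then have "deriv \<rho> H (\<epsilon> \<oplus> \<epsilon>) \<Gamma>" using cut_reduction[OF A(1) _ _ pos neg] eq by simp
    then show ?thesis by (rule deriv_phibarI) (use \<epsilon> \<epsilon>_OT in \<open>simp add: oadd_prec_principal\<close>)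
  next
    case (copies a n)
    have "rk A \<in> H {}" using rk_mem[of "{}" A] control(2) by simp
    then have a: "a \<in> H {}"
      using copies(1,3) sentence_rk_in_OT[OF A(1)] mem_iff_Eset[of "{}"] by blast
    have "\<rho> \<preceq> oadd_copies \<rho> a n" using A(2) copies(4) prec_order.le_less_trans by blast
    then have "deriv (oadd_copies \<rho> a n) H \<epsilon> (insert A \<Gamma>)"
      "deriv (oadd_copies \<rho> a n) H \<epsilon> (insert (neg A) \<Gamma>)"
      using deriv_raise_rank pos neg by blast+
    moreover have "\<epsilon> \<in> seg (\<epsilon> \<oplus> onum 1)" "\<epsilon> \<oplus> onum 1 \<in> H {}"
      using \<epsilon>_OT prec_oadd_one control(1) by (simp_all add: seg_def oadd_mem onum_mem)
    ultimately have "deriv (oadd_copies \<rho> a n) H (\<epsilon> \<oplus> onum 1) \<Gamma>"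
      using deriv_cutI[OF A(1) copies(4)] by blast
    then show ?thesis
    proof (rule deriv_oadd_copies_phibar[OF IH[OF copies(1,2)] a copies(2) \<rho>])
      show "\<epsilon> \<oplus> onum 1 \<prec> phibar \<alpha> \<beta>"
        using \<epsilon> \<epsilon>_OT by (simp add: oadd_prec_principal onum_prec_principal)
    qed
  qed
qed

end

end

lemma cut_elim_at_step:
  assumes "\<And>a. a \<in> OT \<Longrightarrow> a \<prec> \<alpha> \<Longrightarrow> cut_elim_at a" "\<alpha> \<prec> Om" "\<rho> \<in> OT" "\<rho> \<prec> Om"
    and "deriv (\<rho> \<oplus> omega_of \<alpha>) H \<beta> \<Gamma>" "Th_closed_operator H" "\<alpha> \<in> H {}" "\<beta> \<prec> Om"
  shows "deriv \<rho> H (phibar \<alpha> \<beta>) \<Gamma>"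
  using assms(5-)
proof (induction rule: deriv_induct)
  case (inference H \<beta> \<Gamma> P)
  interpret Th_closed_operator H by fact
  have control: "\<beta> \<in> H {}" "kset \<Gamma> \<subseteq> H {}" "phibar \<alpha> \<beta> \<in> H {}"
    using inference phibar_mem assms(2) by auto
  have OT: "\<alpha> \<in> OT" "\<beta> \<in> OT" using inference.prems(2) control(1) mem_imp_in_OT by auto
  note below = assms(2) inference.prems(3)
  have height: "phibar \<alpha> \<gamma> \<in> seg (phibar \<alpha> \<beta>)" if "\<gamma> \<in> seg \<beta>" for \<gamma>
    using that phibar_strict_mono_right[OF OT(1) below(1) OT(2) below(2)] OT phibar_in_OT
    by (simp add: seg_def)
  have eliminated_premise: "deriv \<rho> (adjoin H Z) (phibar \<alpha> \<gamma>) (insert B \<Gamma>)"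
    if "Z \<subseteq> OT" "\<gamma> \<in> seg \<beta>" and IH: "Th_closed_operator (adjoin H Z) \<longrightarrow> \<alpha> \<in> adjoin H Z {} \<longrightarrow> \<gamma> \<prec> Om \<longrightarrow>
        deriv \<rho> (adjoin H Z) (phibar \<alpha> \<gamma>) (insert B \<Gamma>)" for Z \<gamma> B
    using IH Th_closed_operator_adjoin[OF that(1)] adjoin_extends[OF that(1), of "{}"] inference.prems
      seg_prec_trans[OF that(2), of Om] by auto
  from inference.IH show ?case
  proof (cases rule: inference_cut_cases[of _ _ _ _ _ \<rho>])
    case small
    then show ?thesis
    proof (rule deriv_inference_mapI[where h = "phibar \<alpha>"],
        goal_cases rank bound operator height premise principal control)
      case (premise Z \<gamma> B)
      then show ?case by (intro eliminated_premise) blast+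
    qed (use height prec_phibar(2)[OF OT(1) below(1) OT(2) below(2)] control inference.hyps(2) in auto)
  next
    case (large A \<gamma>)
    then have "deriv \<rho> H (phibar \<alpha> \<gamma>) (insert A \<Gamma>)" "deriv \<rho> H (phibar \<alpha> \<gamma>) (insert (neg A) \<Gamma>)"
      using eliminated_premise[of "{}" \<gamma>] by auto
    then show ?thesis
      using large_cut_elim[OF inference.prems(2) below(1) control(1) below(2) assms(1,3,4) large(1-3)]
        height[OF large(4)] by (auto simp: seg_def)
  qed
qed

lemma cut_elim_at_below_Om: "\<alpha> \<in> OT \<Longrightarrow> \<alpha> \<prec> Om \<Longrightarrow> cut_elim_at \<alpha>"
proof (induction rule: seg_Om_induct)
  case (less \<alpha>)
  show ?case
    unfolding cut_elim_at_def using cut_elim_at_step[OF less.IH less.hyps(2)] by blast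
qed

theorem theorem7p8:
  fixes \<alpha> \<beta> \<rho> \<eta> :: oterm and X :: "oterm set" and \<Gamma> :: "idfml set"
  assumes "\<alpha> \<in> OT" "\<alpha> \<prec> Om"
    and "\<beta> \<in> OT" "\<beta> \<prec> Om"
    and "\<rho> \<in> OT" "\<rho> \<prec> Om"
    and "X \<subseteq> OT"
    and "\<eta> \<in> OT" "Omega_times Om \<preceq> \<eta>"
    and "\<alpha> \<in> Hop \<eta> X"
    and "sequent \<Gamma>"
    and "deriv (\<rho> \<oplus> omega_of \<alpha>) (adjoin (Hop \<eta>) X) \<beta> \<Gamma>"
  shows "deriv \<rho> (adjoin (Hop \<eta>) X) (phibar \<alpha> \<beta>) \<Gamma>"
proof -
  interpret Th_closed_operator "Hop \<eta>" using assms(9) by (rule Th_closed_operator_Hop)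
  have "Th_closed_operator (adjoin (Hop \<eta>) X)" using assms(7) by (rule Th_closed_operator_adjoin)
  moreover have "\<alpha> \<in> adjoin (Hop \<eta>) X {}" using assms(10) by (simp add: adjoin_def)
  moreover have "cut_elim_at \<alpha>" using assms(1,2) by (rule cut_elim_at_below_Om)
  ultimately show ?thesis using assms(4-6,12) by (simp add: cut_elim_at_def)
qed

end
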